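(* For $n\ge1$ let $\mu_n=\frac Tn\sum_{i=0}^{n-1}\delta_{iT/n}$, $\mathrm{supp}(\mu_n)=\{0,\frac Tn,\dots,\frac{(n-1)T}{n}\}$, and \[ f_n(t,x)=\mathbb{E}\Big[\exp\Big(\int_t^T\sum_{i=1}^3u_i(s)p_i(X_s)\mu_n(ds)+v(T)q(X_T)\Big)\,\Big|\,X_t=x\Big]. \] Then for $j=0,1,\dots,n-1$: (i) $f_n$ is continuous on $(\frac{jT}{n},\frac{(j+1)T}{n}]\times\mathbb{R}$, and $f_n$ is $C^1$ in $t$ and $C^\infty$ in $x$ on $(\frac{jT}{n},\frac{(j+1)T}{n})\times\mathbb{R}$; (ii) $f_n$ solves \[ (f_n)_t+(f_n)_x(a+bx)+\tfrac12c^2(f_n)_{xx}=0,\quad t\notin\mathrm{supp}(\mu_n)\cup\{T\}, \] \[ \lim_{s\to t^+}f_n(s,x)=f_n(t,x)\exp\Big(-\tfrac Tn\sum_{i=1}^3u_i(t)p_i(x)\Big),\quad t\in\mathrm{supp}(\mu_n),\qquad f_n(T,x)=\exp(v(T)q(x)). \]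
   Context: Let $W$ be a Brownian motion; $a,b\in\mathbb{R}$, $c\ne0$, $T>0$; $dX_t=(a+bX_t)dt+c\,dW_t$. Negligible to double factorial: $\limsup_k(|p_k|(k-1)!!)^{1/k}=0$, $(-1)!!=0!!=1$. Standing assumptions: $u_1,u_2,u_3,v:[0,T]\to\mathbb{C}$ continuous with $\Re(u_1)\le0$, $\Re(u_2)=\Re(u_3)=\Re(v)=0$; $p_1=p^2$ for a real-coefficient power series $p$ negligible to double factorial; $p_2,p_3,q$ real-coefficient power series negligible to double factorial. "$C^\infty$ in $x$": all $x$-derivatives exist and are jointly continuous; "$C^1$ in $t$": $\partial_t$ exists and is jointly continuous. *)

theory Defs
  imports "HOL-Probability.Probability"
begin

fun double_factorial :: "nat \<Rightarrow> nat" where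
  "double_factorial 0 = 1"
| "double_factorial (Suc 0) = 1"
| "double_factorial (Suc (Suc n)) = (n + 2) * double_factorial n"

text \<open>(k-1)!! with the convention (-1)!! = 1.\<close>
definition dfact_pred :: "nat \<Rightarrow> real" where
  "dfact_pred k = (if k = 0 then 1 else real (double_factorial (k - 1)))"

definition negligible_df :: "(nat \<Rightarrow> real) \<Rightarrow> bool" where
  "negligible_df c \<longleftrightarrow>
     limsup (\<lambda>k. ereal (root k (\<bar>c k\<bar> * dfact_pred k))) = 0"

definition pseries :: "(nat \<Rightarrow> real) \<Rightarrow> real \<Rightarrow> real" where
  "pseries c x = (\<Sum>k. c k * x ^ k)"

definition pseries_sq :: "(nat \<Rightarrow> real) \<Rightarrow> nat \<Rightarrow> real" where
  "pseries_sq c k = (\<Sum>i\<le>k. c i * c (k - i))"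

definition brownian_motion :: "'a measure \<Rightarrow> (real \<Rightarrow> 'a \<Rightarrow> real) \<Rightarrow> bool" where
  "brownian_motion M W \<longleftrightarrow>
     prob_space M
   \<and> (\<forall>t\<ge>0. W t \<in> borel_measurable M)
   \<and> (AE \<omega> in M. W 0 \<omega> = 0 \<and> continuous_on {0..} (\<lambda>t. W t \<omega>))
   \<and> (\<forall>s t. 0 \<le> s \<and> s < t \<longrightarrow>
        distributed M lborel (\<lambda>\<omega>. W t \<omega> - W s \<omega>) (normal_density 0 (sqrt (t - s))))
   \<and> (\<forall>(ts :: nat \<Rightarrow> real) k. 0 \<le> ts 0 \<and> (\<forall>i<k. ts i \<le> ts (Suc i)) \<longrightarrow>
        prob_space.indep_vars M (\<lambda>_. borel) (\<lambda>i \<omega>. W (ts (Suc i)) \<omega> - W (ts i) \<omega>) {..<k})"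

definition C1_in_t :: "(real \<times> real) set \<Rightarrow> (real \<Rightarrow> real \<Rightarrow> complex) \<Rightarrow> bool" where
  "C1_in_t S f \<longleftrightarrow> (\<exists>ft. (\<forall>(t, x)\<in>S. ((\<lambda>s. f s x) has_vector_derivative ft t x) (at t))
                         \<and> continuous_on S (\<lambda>(t, x). ft t x))"

definition Cinf_in_x :: "(real \<times> real) set \<Rightarrow> (real \<Rightarrow> real \<Rightarrow> complex) \<Rightarrow> bool" where
  "Cinf_in_x S f \<longleftrightarrow> (\<exists>D :: nat \<Rightarrow> real \<Rightarrow> real \<Rightarrow> complex.
       (\<forall>(t, x)\<in>S. D 0 t x = f t x)
     \<and> (\<forall>k. \<forall>(t, x)\<in>S. ((\<lambda>y. D k t y) has_vector_derivative D (Suc k) t x) (at x))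
     \<and> (\<forall>k. continuous_on S (\<lambda>(t, x). D k t x)))"

end

theory Submission
  imports Defs
begin

text \<open>
  By variation of constants \<open>X\<^sub>s - e\<^bsup>b (s - r)\<^esup> X\<^sub>r - a (e\<^bsup>b (s - r)\<^esup> - 1) / b\<close> is pathwise \<open>c\<close> times the Wiener integral
  of \<open>u \<mapsto> e\<^bsup>b (s - u)\<^esup>\<close> over \<open>[r, s]\<close>, a limit of Riemann-Stieltjes sums because the weight is continuously
  differentiable. The sums are Gaussian, those over successive intervals are independent, and both properties
  survive almost sure limits, so the samples of \<open>X\<close> form an autoregressive chain with independent Gaussian noise.
  Peeling off one noise variable at a time shows \<open>f\<^sub>n(t, \<cdot>) = P\<^bsub>r - t\<^esub> V\<close> on \<open>(jT/n, r]\<close>, where \<open>r = (j + 1)T/n\<close>, \<open>P\<close> is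
  the Ornstein-Uhlenbeck semigroup and \<open>V\<close> is bounded and continuous. Finally \<open>P\<^sub>h V\<close> is a Gaussian convolution,
  whose derivatives come from differentiating the Gaussian density under the integral; the backward equation
  is the heat equation for that density, transported along its mean and variance.
\<close>

section \<open>Pathwise Stieltjes integrals\<close>

definition grid :: "real \<Rightarrow> real \<Rightarrow> nat \<Rightarrow> nat \<Rightarrow> real" where
  "grid r s N k = r + real k * (s - r) / real N"

lemma grid_0 [simp]: "grid r s N 0 = r"
  by (simp add: grid_def)

lemma grid_self [simp]: "0 < N \<Longrightarrow> grid r s N N = s"
  by (simp add: grid_def)

lemma grid_Suc_diff: "grid r s N (Suc k) - grid r s N k = (s - r) / real N"
  by (simp add: grid_def distrib_right add_divide_distrib)

lemma grid_mono: "r \<le> s \<Longrightarrow> k \<le> l \<Longrightarrow> grid r s N k \<le> grid r s N l"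
  unfolding grid_def by (intro add_left_mono divide_right_mono mult_right_mono) auto

lemma grid_in: "r \<le> s \<Longrightarrow> k \<le> N \<Longrightarrow> grid r s N k \<in> {r..s}"
  using grid_mono[of r s 0 k N] grid_mono[of r s k N N] by (cases "N = 0") auto

lemma integral_grid:
  fixes h :: "real \<Rightarrow> real"
  assumes r_le_s: "r \<le> s" and cont: "continuous_on {r..s} h" and k_le_N: "k \<le> N"
  shows "integral {r..grid r s N k} h = (\<Sum>i<k. integral {grid r s N i..grid r s N (Suc i)} h)"
  using k_le_N
proof (induction k)
  case (Suc k)
  let ?t = "grid r s N"
  have grid_order: "r \<le> ?t k" "?t k \<le> ?t (Suc k)" "?t (Suc k) \<le> s"
    using grid_in[OF r_le_s, of k N] grid_in[OF r_le_s Suc.prems]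
      grid_mono[OF r_le_s, of k "Suc k" N] Suc.prems by auto
  have "h integrable_on {r..?t (Suc k)}"
    by (intro integrable_continuous_real continuous_on_subset[OF cont]) (use grid_order in auto)
  from Henstock_Kurzweil_Integration.integral_combine[OF grid_order(1,2) this] Suc show ?case
    by simp
qed simp

definition concat_grid :: "(nat \<Rightarrow> real) \<Rightarrow> nat \<Rightarrow> nat \<Rightarrow> real" where
  "concat_grid \<tau> N i = grid (\<tau> (i div N)) (\<tau> (Suc (i div N))) N (i mod N)"

lemma concat_grid_eq_grid:
  assumes "0 < N" and "l \<le> N"
  shows "concat_grid \<tau> N (k * N + l) = grid (\<tau> k) (\<tau> (Suc k)) N l"
proof (cases "l = N")
  case True
  hence "k * N + l = Suc k * N" by simp
  thus ?thesis using assms True by (simp add: concat_grid_def del: mult_Suc)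
qed (use assms in \<open>auto simp: concat_grid_def\<close>)

lemma concat_grid_le_Suc:
  assumes "0 < N" and mono: "\<And>k. k < m \<Longrightarrow> \<tau> k \<le> \<tau> (Suc k)" and "i < m * N"
  shows "concat_grid \<tau> N i \<le> concat_grid \<tau> N (Suc i)"
proof -
  define k l where "k = i div N" and "l = i mod N"
  have "i = k * N + l" "l < N" "k < m"
    using assms by (auto simp: k_def l_def less_mult_imp_div_less)
  thus ?thesis
    using concat_grid_eq_grid[OF \<open>0 < N\<close>, of l \<tau> k] concat_grid_eq_grid[OF \<open>0 < N\<close>, of "Suc l" \<tau> k]
      grid_mono[OF mono, of k l "Suc l" N] by simp
qed

definition stieltjes_sum :: "(real \<Rightarrow> real) \<Rightarrow> (real \<Rightarrow> real) \<Rightarrow> real \<Rightarrow> real \<Rightarrow> nat \<Rightarrow> real" where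
  "stieltjes_sum g w r s N = (\<Sum>k<N. g (grid r s N k) * (w (grid r s N (Suc k)) - w (grid r s N k)))"

lemma stieltjes_sum_degenerate [simp]: "stieltjes_sum g w r r N = 0"
  by (simp add: stieltjes_sum_def grid_def)

lemma stieltjes_sum_by_parts:
  assumes "0 < N"
  shows "stieltjes_sum g w r s N = g s * w s - g r * w r
    - (\<Sum>k<N. w (grid r s N (Suc k)) * (g (grid r s N (Suc k)) - g (grid r s N k)))"
proof -
  let ?t = "grid r s N"
  have "g s * w s - g r * w r = (\<Sum>k<N. g (?t (Suc k)) * w (?t (Suc k)) - g (?t k) * w (?t k))"
    using assms by (subst sum_lessThan_telescope) simp
  thus ?thesis
    by (simp add: stieltjes_sum_def sum_subtractf[symmetric] algebra_simps)
qed

lemma integral_deriv_mult_approx: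
  fixes g g' w :: "real \<Rightarrow> real"
  assumes u_le_v: "u \<le> v"
    and deriv: "\<And>x. x \<in> {u..v} \<Longrightarrow> (g has_real_derivative g' x) (at x)"
    and cont: "continuous_on {u..v} g'" "continuous_on {u..v} w"
    and bound: "\<And>x. x \<in> {u..v} \<Longrightarrow> \<bar>g' x\<bar> \<le> B"
    and oscillation: "\<And>x. x \<in> {u..v} \<Longrightarrow> \<bar>w v - w x\<bar> \<le> e"
  shows "\<bar>w v * (g v - g u) - integral {u..v} (\<lambda>x. g' x * w x)\<bar> \<le> B * e * (v - u)"
proof -
  have "(g' has_integral g v - g u) {u..v}"
    using deriv u_le_v by (intro fundamental_theorem_of_calculus)
      (auto simp: has_real_derivative_iff_has_vector_derivative[symmetric] intro: has_field_derivative_at_within)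
  hence "((\<lambda>x. w v * g' x) has_integral w v * (g v - g u)) {u..v}"
    by (rule has_integral_mult_right)
  moreover have "((\<lambda>x. g' x * w x) has_integral integral {u..v} (\<lambda>x. g' x * w x)) {u..v}"
    by (intro integrable_integral integrable_continuous_real continuous_intros cont)
  ultimately have error_integral: "((\<lambda>x. w v * g' x - g' x * w x) has_integral
      w v * (g v - g u) - integral {u..v} (\<lambda>x. g' x * w x)) {u..v}"
    by (rule has_integral_diff)
  have "norm (w v * (g v - g u) - integral {u..v} (\<lambda>x. g' x * w x))
      \<le> B * e * Henstock_Kurzweil_Integration.content {u..v}"
  proof (rule has_integral_bound_real[OF _ finite.emptyI error_integral])
    show "0 \<le> B * e" using bound[of u] oscillation[of u] u_le_v by (simp add: abs_le_iff)
    fix x assume x_in: "x \<in> {u..v} - {}"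
    have "norm (w v * g' x - g' x * w x) = \<bar>g' x\<bar> * \<bar>w v - w x\<bar>"
      by (simp add: abs_mult[symmetric] algebra_simps)
    also have "\<dots> \<le> B * e" using x_in bound oscillation by (intro mult_mono) (auto intro: order_trans[OF abs_ge_zero])
    finally show "norm (w v * g' x - g' x * w x) \<le> B * e" .
  qed
  thus ?thesis using u_le_v by simp
qed

lemma stieltjes_sum_error:
  fixes g g' w :: "real \<Rightarrow> real"
  assumes r_le_s: "r \<le> s" and N_pos: "0 < N"
    and deriv: "\<And>u. u \<in> {r..s} \<Longrightarrow> (g has_real_derivative g' u) (at u)"
    and cont: "continuous_on {r..s} g'" "continuous_on {r..s} w"
    and bound: "\<And>u. u \<in> {r..s} \<Longrightarrow> \<bar>g' u\<bar> \<le> B"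
    and oscillation: "\<And>u v. u \<in> {r..s} \<Longrightarrow> v \<in> {r..s} \<Longrightarrow> \<bar>v - u\<bar> \<le> (s - r) / real N \<Longrightarrow> \<bar>w v - w u\<bar> \<le> e"
  shows "\<bar>stieltjes_sum g w r s N - (g s * w s - g r * w r - integral {r..s} (\<lambda>u. g' u * w u))\<bar>
    \<le> B * e * (s - r)"
proof -
  let ?t = "grid r s N"
  let ?I = "\<lambda>k. integral {?t k..?t (Suc k)} (\<lambda>u. g' u * w u)"
  have "integral {r..s} (\<lambda>u. g' u * w u) = (\<Sum>k<N. ?I k)"
    using integral_grid[OF r_le_s, of "\<lambda>u. g' u * w u" N N] cont N_pos by (simp add: continuous_on_mult)
  hence "\<bar>stieltjes_sum g w r s N - (g s * w s - g r * w r - integral {r..s} (\<lambda>u. g' u * w u))\<bar>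
      = \<bar>\<Sum>k<N. w (?t (Suc k)) * (g (?t (Suc k)) - g (?t k)) - ?I k\<bar>"
    by (simp add: stieltjes_sum_by_parts[OF N_pos] sum_subtractf)
  also have "\<dots> \<le> (\<Sum>k<N. B * e * (?t (Suc k) - ?t k))"
  proof (rule order_trans[OF sum_abs], rule sum_mono)
    fix k assume k_less: "k \<in> {..<N}"
    have step: "?t k \<le> ?t (Suc k)" "{?t k..?t (Suc k)} \<subseteq> {r..s}"
      using grid_mono[OF r_le_s, of k "Suc k"] grid_in[OF r_le_s, of k N]
        grid_in[OF r_le_s, of "Suc k" N] k_less by auto
    show "\<bar>w (?t (Suc k)) * (g (?t (Suc k)) - g (?t k)) - ?I k\<bar> \<le> B * e * (?t (Suc k) - ?t k)"
    proof (rule integral_deriv_mult_approx[OF step(1)])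
      fix u assume u_in: "u \<in> {?t k..?t (Suc k)}"
      show "\<bar>w (?t (Suc k)) - w u\<bar> \<le> e"
        using u_in step k_less grid_Suc_diff[of r s N k] by (intro oscillation) auto
    qed (use deriv bound step(2) cont in \<open>auto intro: continuous_on_subset\<close>)
  qed
  also have "\<dots> = B * e * (s - r)"
    using N_pos by (simp add: grid_Suc_diff)
  finally show ?thesis .
qed

lemma stieltjes_sum_tendsto:
  fixes g g' w :: "real \<Rightarrow> real"
  assumes r_le_s: "r \<le> s"
    and deriv: "\<And>u. u \<in> {r..s} \<Longrightarrow> (g has_real_derivative g' u) (at u)"
    and cont: "continuous_on {r..s} g'" "continuous_on {r..s} w"
  shows "stieltjes_sum g w r s \<longlonglongrightarrow> g s * w s - g r * w r - integral {r..s} (\<lambda>u. g' u * w u)"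
    (is "_ \<longlonglongrightarrow> ?L")
proof (rule LIMSEQ_I)
  fix \<epsilon> :: real assume \<epsilon>_pos: "0 < \<epsilon>"
  obtain B where deriv_bound: "\<And>u. u \<in> {r..s} \<Longrightarrow> \<bar>g' u\<bar> \<le> B"
    using continuous_on_compact_bound[OF compact_Icc cont(1)] by (metis real_norm_def)
  have bound_nonneg: "0 \<le> B * (s - r)"
    using deriv_bound[of r] r_le_s by simp
  define e where "e = \<epsilon> / (B * (s - r) + 1)"
  have e_small: "0 < e" "e * (B * (s - r)) < \<epsilon>"
    using \<epsilon>_pos bound_nonneg by (auto simp: e_def field_simps)
  obtain d where uniform: "0 < d"
    "\<And>u v. u \<in> {r..s} \<Longrightarrow> v \<in> {r..s} \<Longrightarrow> dist v u < d \<Longrightarrow> dist (w v) (w u) < e"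
    using compact_uniformly_continuous[OF cont(2) compact_Icc] e_small(1)
    unfolding uniformly_continuous_on_def by metis
  have "\<forall>\<^sub>F N in sequentially. (s - r) / real N < d \<and> 0 < N"
    using order_tendstoD(2)[OF lim_const_over_n uniform(1)] eventually_gt_at_top[of 0]
    by (rule eventually_conj)
  then obtain N0 where mesh_small: "\<And>N. N0 \<le> N \<Longrightarrow> (s - r) / real N < d \<and> 0 < N"
    by (auto simp: eventually_sequentially)
  show "\<exists>N0. \<forall>N\<ge>N0. norm (stieltjes_sum g w r s N - ?L) < \<epsilon>"
  proof (intro exI[of _ N0] allI impI)
    fix N assume N_large: "N0 \<le> N"
    have "\<bar>stieltjes_sum g w r s N - ?L\<bar> \<le> B * e * (s - r)"
      using mesh_small[OF N_large] uniform(2) by (intro stieltjes_sum_error[OF r_le_s _ deriv cont deriv_bound])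
        (fastforce simp: dist_real_def)+
    thus "norm (stieltjes_sum g w r s N - ?L) < \<epsilon>"
      using e_small(2) by (simp add: mult_ac)
  qed
qed

lemma C1_differentiable_on_realE:
  fixes g :: "real \<Rightarrow> real"
  assumes "g C1_differentiable_on S"
  obtains g' where "\<And>u. u \<in> S \<Longrightarrow> (g has_real_derivative g' u) (at u)" "continuous_on S g'"
  using assms unfolding C1_differentiable_on_def has_real_derivative_iff_has_vector_derivative by blast

text \<open>Defined as a limit so that Wiener integrals are measurable whether or not all paths are continuous.\<close>
definition stieltjes_integral :: "(real \<Rightarrow> real) \<Rightarrow> (real \<Rightarrow> real) \<Rightarrow> real \<Rightarrow> real \<Rightarrow> real" where
  "stieltjes_integral g w r s = lim (stieltjes_sum g w r s)"

lemma stieltjes_integral_eq: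
  assumes "r \<le> s" and "\<And>u. u \<in> {r..s} \<Longrightarrow> (g has_real_derivative g' u) (at u)"
    and "continuous_on {r..s} g'" "continuous_on {r..s} w"
  shows "stieltjes_integral g w r s = g s * w s - g r * w r - integral {r..s} (\<lambda>u. g' u * w u)"
  unfolding stieltjes_integral_def by (rule limI[OF stieltjes_sum_tendsto[OF assms]])

lemma stieltjes_sum_tendsto_integral:
  assumes r_le_s: "r \<le> s" and g_C1: "g C1_differentiable_on {r..s}" and w_cont: "continuous_on {r..s} w"
  shows "stieltjes_sum g w r s \<longlonglongrightarrow> stieltjes_integral g w r s"
proof -
  obtain g' where "\<And>u. u \<in> {r..s} \<Longrightarrow> (g has_real_derivative g' u) (at u)" "continuous_on {r..s} g'"
    using C1_differentiable_on_realE[OF g_C1] by blast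
  from stieltjes_sum_tendsto[OF r_le_s this w_cont] stieltjes_integral_eq[OF r_le_s this w_cont] show ?thesis
    by simp
qed

lemma stieltjes_sum_id_tendsto:
  assumes r_le_s: "r \<le> s" and g_C1: "g C1_differentiable_on {r..s}"
  shows "stieltjes_sum g (\<lambda>u. u) r s \<longlonglongrightarrow> integral {r..s} g"
proof -
  obtain g' where deriv: "\<And>u. u \<in> {r..s} \<Longrightarrow> (g has_real_derivative g' u) (at u)" "continuous_on {r..s} g'"
    using C1_differentiable_on_realE[OF g_C1] by blast
  have "continuous_on {r..s} g"
    using g_C1 by (rule C1_differentiable_imp_continuous_on)
  hence integrable: "g integrable_on {r..s}" "(\<lambda>u. g' u * u) integrable_on {r..s}"
    by (auto intro!: integrable_continuous_real continuous_intros deriv(2))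
  have "((\<lambda>u. g u + g' u * u) has_integral g s * s - g r * r) {r..s}"
    using r_le_s by (intro fundamental_theorem_of_calculus)
      (auto intro!: derivative_eq_intros has_field_derivative_at_within[OF deriv(1)]
        simp: has_real_derivative_iff_has_vector_derivative[symmetric])
  hence "integral {r..s} g = g s * s - g r * r - integral {r..s} (\<lambda>u. g' u * u)"
    using Henstock_Kurzweil_Integration.integral_add[OF integrable] by (simp add: integral_unique)
  with stieltjes_sum_tendsto[OF r_le_s deriv continuous_on_id] show ?thesis
    by simp
qed

section \<open>Linear equations driven by a continuous path\<close>

definition expm1_quot :: "real \<Rightarrow> real \<Rightarrow> real" where
  "expm1_quot b s = (if b = 0 then s else (exp (b * s) - 1) / b)"

lemma expm1_quot_0 [simp]: "expm1_quot b 0 = 0"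
  by (simp add: expm1_quot_def)

lemma expm1_quot_pos: "0 < s \<Longrightarrow> 0 < expm1_quot b s"
  by (cases b "0 :: real" rule: linorder_cases)
     (auto simp: expm1_quot_def divide_simps mult_neg_pos)

lemma has_real_derivative_expm1_quot [derivative_intros]:
  assumes "(g has_real_derivative g') (at x within S)"
  shows "((\<lambda>x. expm1_quot b (g x)) has_real_derivative exp (b * g x) * g') (at x within S)"
  using assms unfolding expm1_quot_def
  by (cases "b = 0") (auto intro!: derivative_eq_intros)

lemma continuous_on_expm1_quot [continuous_intros]:
  fixes g :: "'a::topological_space \<Rightarrow> real"
  assumes "continuous_on S g"
  shows "continuous_on S (\<lambda>x. expm1_quot b (g x))"
  using assms unfolding expm1_quot_def
  by (cases "b = 0") (auto intro!: continuous_intros)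

lemma has_integral_exp_decay:
  assumes "r \<le> s"
  shows "((\<lambda>u. exp (b * (s - u))) has_integral expm1_quot b (s - r)) {r..s}"
proof -
  have "((\<lambda>u. exp (b * (s - u))) has_integral (- expm1_quot b (s - s)) - (- expm1_quot b (s - r))) {r..s}"
    using assms by (intro fundamental_theorem_of_calculus)
      (auto intro!: derivative_eq_intros simp: has_real_derivative_iff_has_vector_derivative[symmetric])
  thus ?thesis by simp
qed

lemma C1_differentiable_on_exp_decay: "(\<lambda>u::real. exp (b * (s - u))) C1_differentiable_on S"
  unfolding C1_differentiable_on_def has_real_derivative_iff_has_vector_derivative[symmetric]
proof (intro exI[of _ "\<lambda>u. - b * exp (b * (s - u))"] conjI ballI)
  show "((\<lambda>u. exp (b * (s - u))) has_real_derivative - b * exp (b * (s - u))) (at u)" for u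
    by (auto intro!: derivative_eq_intros)
qed (intro continuous_intros)

definition solves_linear ::
    "real \<Rightarrow> real \<Rightarrow> real \<Rightarrow> (real \<Rightarrow> real) \<Rightarrow> real \<Rightarrow> real \<Rightarrow> (real \<Rightarrow> real) \<Rightarrow> bool" where
  "solves_linear a b c w r s y \<longleftrightarrow> continuous_on {r..s} y
    \<and> (\<forall>u\<in>{r..s}. y u = y r + integral {r..u} (\<lambda>x. a + b * y x) + c * (w u - w r))"

lemma solves_linear_subinterval:
  assumes solution: "solves_linear a b c w t T y" and order: "t \<le> r" "r \<le> s" "s \<le> T"
  shows "solves_linear a b c w r s y"
  unfolding solves_linear_def
proof (intro conjI ballI)
  have cont: "continuous_on {t..T} y"
    and y_eq: "\<And>u. u \<in> {t..T} \<Longrightarrow> y u = y t + integral {t..u} (\<lambda>x. a + b * y x) + c * (w u - w t)"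
    using solution unfolding solves_linear_def by blast+
  show "continuous_on {r..s} y"
    by (rule continuous_on_subset[OF cont]) (use order in auto)
  fix u assume u_in: "u \<in> {r..s}"
  have "(\<lambda>x. a + b * y x) integrable_on {t..u}"
    by (intro integrable_continuous_real continuous_intros continuous_on_subset[OF cont]) (use order u_in in auto)
  hence "integral {t..r} (\<lambda>x. a + b * y x) + integral {r..u} (\<lambda>x. a + b * y x) = integral {t..u} (\<lambda>x. a + b * y x)"
    using order u_in by (intro Henstock_Kurzweil_Integration.integral_combine) auto
  thus "y u = y r + integral {r..u} (\<lambda>x. a + b * y x) + c * (w u - w r)"
    using y_eq[of u] y_eq[of r] order u_in by (simp add: algebra_simps)
qed

lemma solves_linear_has_derivative:
  assumes solution: "solves_linear a b c w r s y" and u_in: "u \<in> {r..s}"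
  shows "((\<lambda>u. y u - c * w u) has_real_derivative a + b * y u) (at u within {r..s})"
proof -
  have y_cont: "continuous_on {r..s} y"
    and y_eq: "\<And>u. u \<in> {r..s} \<Longrightarrow> y u = y r + integral {r..u} (\<lambda>x. a + b * y x) + c * (w u - w r)"
    using solution unfolding solves_linear_def by blast+
  have "((\<lambda>u. integral {r..u} (\<lambda>x. a + b * y x)) has_real_derivative a + b * y u) (at u within {r..s})"
    by (intro integral_has_real_derivative continuous_intros y_cont u_in)
  from DERIV_add[OF DERIV_const this, of "y r - c * w r"]
  have deriv: "((\<lambda>u. (y r - c * w r) + integral {r..u} (\<lambda>x. a + b * y x)) has_vector_derivative a + b * y u)
      (at u within {r..s})"
    by (simp add: has_real_derivative_iff_has_vector_derivative)
  have "y v - c * w v = (y r - c * w r) + integral {r..v} (\<lambda>x. a + b * y x)" if "v \<in> {r..s}" for v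
    using y_eq[OF that] by (simp add: algebra_simps)
  from has_vector_derivative_transform[OF u_in this deriv] show ?thesis
    by (simp add: has_real_derivative_iff_has_vector_derivative)
qed

lemma variation_of_constants:
  assumes r_le_s: "r \<le> s" and w_cont: "continuous_on {r..s} w" and solution: "solves_linear a b c w r s y"
  shows "y s = exp (b * (s - r)) * y r + a * expm1_quot b (s - r)
    + c * stieltjes_integral (\<lambda>u. exp (b * (s - u))) w r s"
proof -
  define E where "E = (\<lambda>u. exp (b * (s - u)))"
  define z where "z = (\<lambda>u. y u - c * w u)"
  have E_deriv: "(E has_real_derivative - b * E u) (at u within S)" for u S
    unfolding E_def by (auto intro!: derivative_eq_intros)
  have z_deriv: "(z has_real_derivative a + b * y u) (at u within {r..s})" if "u \<in> {r..s}" for u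
    unfolding z_def by (rule solves_linear_has_derivative[OF solution that])
  have "((\<lambda>u. a * E u + c * (b * E u * w u)) has_integral E s * z s - E r * z r) {r..s}"
  proof (intro fundamental_theorem_of_calculus r_le_s)
    fix u assume "u \<in> {r..s}"
    from DERIV_mult[OF E_deriv z_deriv[OF this]]
    show "((\<lambda>u. E u * z u) has_vector_derivative a * E u + c * (b * E u * w u)) (at u within {r..s})"
      by (simp add: has_real_derivative_iff_has_vector_derivative z_def algebra_simps)
  qed
  moreover have "((\<lambda>u. a * E u + c * (b * E u * w u)) has_integral
      a * expm1_quot b (s - r) + c * integral {r..s} (\<lambda>u. b * E u * w u)) {r..s}"
  proof (intro has_integral_add has_integral_mult_right integrable_integral)
    show "(E has_integral expm1_quot b (s - r)) {r..s}"
      unfolding E_def by (rule has_integral_exp_decay[OF r_le_s])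
    show "(\<lambda>u. b * E u * w u) integrable_on {r..s}"
      unfolding E_def by (intro integrable_continuous_real continuous_intros w_cont)
  qed
  ultimately have z_diff: "E s * z s - E r * z r
      = a * expm1_quot b (s - r) + c * integral {r..s} (\<lambda>u. b * E u * w u)"
    by (rule has_integral_unique)
  have parts: "stieltjes_integral E w r s = w s - E r * w r + integral {r..s} (\<lambda>u. b * E u * w u)"
    by (subst stieltjes_integral_eq[OF r_le_s E_deriv _ w_cont]) (auto simp: E_def intro!: continuous_intros)
  from z_diff show ?thesis
    unfolding E_def[symmetric] parts by (simp add: z_def E_def algebra_simps)
qed

section \<open>Independence\<close>

definition closed_approx :: "'a::metric_space set \<Rightarrow> nat \<Rightarrow> 'a \<Rightarrow> real" where
  "closed_approx C k x = (if C = {} then 0 else inverse (1 + real k * infdist x C))"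

lemma continuous_on_closed_approx: "continuous_on S (closed_approx C k)"
proof (cases "C = {}")
  case False
  have "1 + real k * infdist x C \<noteq> 0" for x
    using infdist_nonneg[of x C] by (simp add: add_nonneg_eq_0_iff)
  with False show ?thesis
    unfolding closed_approx_def[abs_def] by (auto intro!: continuous_intros)
qed (simp add: closed_approx_def[abs_def])

lemma abs_closed_approx_le_1: "\<bar>closed_approx C k x\<bar> \<le> 1"
  using infdist_nonneg[of x C] by (auto simp: closed_approx_def inverse_le_1_iff abs_of_nonneg)

lemma closed_approx_tendsto_indicator:
  assumes "closed C"
  shows "(\<lambda>k. closed_approx C k x) \<longlonglongrightarrow> indicator C x"
proof (cases "x \<in> C \<or> C = {}")
  case False
  hence "0 < infdist x C"
    using assms by (simp add: infdist_pos_not_in_closed)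
  hence "(\<lambda>k. inverse (1 + real k * infdist x C)) \<longlonglongrightarrow> 0"
    by (intro tendsto_inverse_0_at_top filterlim_tendsto_add_at_top[OF tendsto_const]
        filterlim_at_top_mult_tendsto_pos[OF tendsto_const] filterlim_real_sequentially)
  thus ?thesis using False by (simp add: closed_approx_def)
next
  case True
  thus ?thesis by (cases "C = {}") (simp_all add: closed_approx_def)
qed

context prob_space
begin

lemma expectation_prod_indicator_closed:
  fixes Z :: "'i \<Rightarrow> 'a \<Rightarrow> 'b::metric_space"
  assumes Z_measurable [measurable]: "\<And>i. i \<in> I \<Longrightarrow> Z i \<in> borel_measurable M"
    and prod: "\<And>\<psi> :: 'i \<Rightarrow> 'b \<Rightarrow> real. (\<And>i. continuous_on UNIV (\<psi> i)) \<Longrightarrow> (\<And>i z. \<bar>\<psi> i z\<bar> \<le> 1) \<Longrightarrow>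
      expectation (\<lambda>\<omega>. \<Prod>i\<in>I. \<psi> i (Z i \<omega>)) = (\<Prod>i\<in>I. expectation (\<lambda>\<omega>. \<psi> i (Z i \<omega>)))"
    and closed: "\<And>i. i \<in> I \<Longrightarrow> closed (C i)"
  shows "expectation (\<lambda>\<omega>. \<Prod>i\<in>I. indicat_real (C i) (Z i \<omega>))
    = (\<Prod>i\<in>I. expectation (\<lambda>\<omega>. indicat_real (C i) (Z i \<omega>)))"
proof -
  define \<psi> where "\<psi> = (\<lambda>k i. closed_approx (C i) k)"
  have cont: "continuous_on UNIV (\<psi> k i)" and bound: "\<bar>\<psi> k i z\<bar> \<le> 1" for k i z
    unfolding \<psi>_def by (rule continuous_on_closed_approx, rule abs_closed_approx_le_1)
  have [measurable]: "\<psi> k i \<in> borel_measurable borel" for k i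
    by (rule borel_measurable_continuous_onI[OF cont])
  have [measurable]: "C i \<in> sets borel" if "i \<in> I" for i
    using closed[OF that] by simp
  have limit: "(\<lambda>k. \<psi> k i z) \<longlonglongrightarrow> indicator (C i) z" if "i \<in> I" for i z
    unfolding \<psi>_def by (rule closed_approx_tendsto_indicator[OF closed[OF that]])
  have "(\<lambda>k. expectation (\<lambda>\<omega>. \<Prod>i\<in>I. \<psi> k i (Z i \<omega>)))
      \<longlonglongrightarrow> expectation (\<lambda>\<omega>. \<Prod>i\<in>I. indicat_real (C i) (Z i \<omega>))"
  proof (rule integral_dominated_convergence[where w = "\<lambda>_. 1"])
    show "AE \<omega> in M. (\<lambda>k. \<Prod>i\<in>I. \<psi> k i (Z i \<omega>)) \<longlonglongrightarrow> (\<Prod>i\<in>I. indicat_real (C i) (Z i \<omega>))"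
      by (intro AE_I2 tendsto_prod limit)
    show "AE \<omega> in M. norm (\<Prod>i\<in>I. \<psi> k i (Z i \<omega>)) \<le> 1" for k
      by (simp add: abs_prod prod_le_1 bound)
  qed auto
  moreover have "(\<lambda>k. \<Prod>i\<in>I. expectation (\<lambda>\<omega>. \<psi> k i (Z i \<omega>)))
      \<longlonglongrightarrow> (\<Prod>i\<in>I. expectation (\<lambda>\<omega>. indicat_real (C i) (Z i \<omega>)))"
  proof (intro tendsto_prod integral_dominated_convergence[where w = "\<lambda>_. 1"])
    show "AE \<omega> in M. (\<lambda>k. \<psi> k i (Z i \<omega>)) \<longlonglongrightarrow> indicator (C i) (Z i \<omega>)" if "i \<in> I" for i
      using that by (intro AE_I2 limit)
  qed (auto simp: bound)
  ultimately show ?thesis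
    unfolding prod[OF cont bound] by (rule LIMSEQ_unique)
qed

lemma indep_varsI_expectation_prod:
  fixes Z :: "'i \<Rightarrow> 'a \<Rightarrow> 'b::metric_space"
  assumes finite: "finite I" and Z_measurable [measurable]: "\<And>i. i \<in> I \<Longrightarrow> Z i \<in> borel_measurable M"
    and prod: "\<And>\<psi> :: 'i \<Rightarrow> 'b \<Rightarrow> real. (\<And>i. continuous_on UNIV (\<psi> i)) \<Longrightarrow> (\<And>i z. \<bar>\<psi> i z\<bar> \<le> 1) \<Longrightarrow>
      expectation (\<lambda>\<omega>. \<Prod>i\<in>I. \<psi> i (Z i \<omega>)) = (\<Prod>i\<in>I. expectation (\<lambda>\<omega>. \<psi> i (Z i \<omega>)))"
  shows "indep_vars (\<lambda>_. borel) Z I"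
proof (cases "I = {}")
  case True
  thus ?thesis by (simp add: indep_vars_def indep_sets_def)
next
  case False
  show ?thesis
  proof (subst indep_vars_finite[where E = "\<lambda>_. Collect closed"])
    show "\<forall>C\<in>I \<rightarrow> Collect closed.
        prob (\<Inter>j\<in>I. Z j -` C j \<inter> space M) = (\<Prod>j\<in>I. prob (Z j -` C j \<inter> space M))"
    proof
      fix C :: "'i \<Rightarrow> 'b set" assume "C \<in> I \<rightarrow> Collect closed"
      hence closed: "closed (C i)" if "i \<in> I" for i using that by auto
      have "prob (\<Inter>j\<in>I. Z j -` C j \<inter> space M) = expectation (indicator (\<Inter>j\<in>I. Z j -` C j \<inter> space M))"
        using False by (simp add: Int_absorb2 INT_subset_iff)
      also have "\<dots> = expectation (\<lambda>\<omega>. \<Prod>i\<in>I. indicat_real (C i) (Z i \<omega>))"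
        using finite False by (intro Bochner_Integration.integral_cong) (auto simp: indicator_def prod_zero_iff)
      also have "\<dots> = (\<Prod>i\<in>I. expectation (\<lambda>\<omega>. indicat_real (C i) (Z i \<omega>)))"
        by (rule expectation_prod_indicator_closed[OF Z_measurable prod closed])
      also have "\<dots> = (\<Prod>i\<in>I. expectation (indicator (Z i -` C i \<inter> space M)))"
        by (intro prod.cong Bochner_Integration.integral_cong) (auto simp: indicator_def)
      finally show "prob (\<Inter>j\<in>I. Z j -` C j \<inter> space M) = (\<Prod>j\<in>I. prob (Z j -` C j \<inter> space M))"
        by simp
    qed
    show "sets (borel :: 'b measure) = sigma_sets (space borel) (Collect closed)"
      by (simp add: borel_eq_closed)
  qed (use finite False in \<open>auto simp: Int_stable_def\<close>)
qed

lemma indep_vars_LIMSEQ: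
  fixes Z :: "'i \<Rightarrow> 'a \<Rightarrow> 'b::metric_space"
  assumes finite: "finite I" and Z_measurable [measurable]: "\<And>i. i \<in> I \<Longrightarrow> Z i \<in> borel_measurable M"
    and indep: "\<And>N. indep_vars (\<lambda>_. borel) (Y N) I"
    and limit: "\<And>i. i \<in> I \<Longrightarrow> AE \<omega> in M. (\<lambda>N. Y N i \<omega>) \<longlonglongrightarrow> Z i \<omega>"
  shows "indep_vars (\<lambda>_. borel) Z I"
proof (rule indep_varsI_expectation_prod[OF finite Z_measurable])
  fix \<psi> :: "'i \<Rightarrow> 'b \<Rightarrow> real"
  assume cont: "\<And>i. continuous_on UNIV (\<psi> i)" and bound: "\<And>i z. \<bar>\<psi> i z\<bar> \<le> 1"
  have [measurable]: "\<psi> i \<in> borel_measurable borel" for i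
    by (rule borel_measurable_continuous_onI[OF cont])
  have [measurable]: "Y N i \<in> borel_measurable M" if "i \<in> I" for N i
    using indep that by (auto simp: indep_vars_def)
  have \<psi>_lim: "(\<lambda>N. \<psi> i (y N)) \<longlonglongrightarrow> \<psi> i z" if "y \<longlonglongrightarrow> z" for i y z
    by (rule continuous_on_tendsto_compose[OF cont that]) auto
  have "(\<lambda>N. expectation (\<lambda>\<omega>. \<Prod>i\<in>I. \<psi> i (Y N i \<omega>))) \<longlonglongrightarrow> expectation (\<lambda>\<omega>. \<Prod>i\<in>I. \<psi> i (Z i \<omega>))"
  proof (rule integral_dominated_convergence[where w = "\<lambda>_. 1"])
    have "AE \<omega> in M. \<forall>i\<in>I. (\<lambda>N. Y N i \<omega>) \<longlonglongrightarrow> Z i \<omega>"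
      by (rule AE_finite_allI[OF finite limit])
    thus "AE \<omega> in M. (\<lambda>N. \<Prod>i\<in>I. \<psi> i (Y N i \<omega>)) \<longlonglongrightarrow> (\<Prod>i\<in>I. \<psi> i (Z i \<omega>))"
      by eventually_elim (intro tendsto_prod \<psi>_lim, blast)
    show "AE \<omega> in M. norm (\<Prod>i\<in>I. \<psi> i (Y N i \<omega>)) \<le> 1" for N
      by (simp add: abs_prod prod_le_1 bound)
  qed auto
  moreover have "(\<lambda>N. \<Prod>i\<in>I. expectation (\<lambda>\<omega>. \<psi> i (Y N i \<omega>))) \<longlonglongrightarrow> (\<Prod>i\<in>I. expectation (\<lambda>\<omega>. \<psi> i (Z i \<omega>)))"
  proof (intro tendsto_prod integral_dominated_convergence[where w = "\<lambda>_. 1"])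
    fix i assume "i \<in> I"
    from limit[OF this] show "AE \<omega> in M. (\<lambda>N. \<psi> i (Y N i \<omega>)) \<longlonglongrightarrow> \<psi> i (Z i \<omega>)"
      by eventually_elim (rule \<psi>_lim)
  qed (auto simp: bound)
  moreover have "expectation (\<lambda>\<omega>. \<Prod>i\<in>I. \<psi> i (Y N i \<omega>)) = (\<Prod>i\<in>I. expectation (\<lambda>\<omega>. \<psi> i (Y N i \<omega>)))" for N
  proof (rule indep_vars_lebesgue_integral[OF finite])
    show "indep_vars (\<lambda>_. borel) (\<lambda>i \<omega>. \<psi> i (Y N i \<omega>)) I"
      by (rule indep_vars_compose2[OF indep]) measurable
    show "integrable M (\<lambda>\<omega>. \<psi> i (Y N i \<omega>))" if "i \<in> I" for i
      using that bound by (intro integrable_const_bound[where B = 1]) auto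
  qed
  ultimately show "expectation (\<lambda>\<omega>. \<Prod>i\<in>I. \<psi> i (Z i \<omega>)) = (\<Prod>i\<in>I. expectation (\<lambda>\<omega>. \<psi> i (Z i \<omega>)))"
    by (simp add: LIMSEQ_unique)
qed

lemma expectation_indep_var:
  fixes \<Psi> :: "'b \<times> 'b \<Rightarrow> 'c::{banach, second_countable_topology}"
  assumes indep: "indep_var S A R B" and [measurable]: "\<Psi> \<in> borel_measurable (S \<Otimes>\<^sub>M R)"
    and bound: "\<And>p. norm (\<Psi> p) \<le> C"
  shows "(\<integral>\<omega>. \<Psi> (A \<omega>, B \<omega>) \<partial>M) = (\<integral>\<omega>. (\<integral>\<omega>'. \<Psi> (A \<omega>, B \<omega>') \<partial>M) \<partial>M)"
proof -
  have [measurable]: "A \<in> measurable M S" "B \<in> measurable M R"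
    and distr_pair: "distr M S A \<Otimes>\<^sub>M distr M R B = distr M (S \<Otimes>\<^sub>M R) (\<lambda>\<omega>. (A \<omega>, B \<omega>))"
    using indep by (auto simp: indep_var_distribution_eq)
  interpret SA: prob_space "distr M S A" by (rule prob_space_distr) measurable
  interpret RB: prob_space "distr M R B" by (rule prob_space_distr) measurable
  interpret P: pair_prob_space "distr M S A" "distr M R B" ..
  have "integrable (distr M S A \<Otimes>\<^sub>M distr M R B) \<Psi>"
    by (rule P.integrable_const_bound[where B = C]) (use bound in auto)
  hence "integral\<^sup>L (distr M S A \<Otimes>\<^sub>M distr M R B) \<Psi>
      = (\<integral>x. (\<integral>y. \<Psi> (x, y) \<partial>distr M R B) \<partial>distr M S A)"
    by (rule P.integral_fst'[symmetric])
  also have "\<dots> = (\<integral>x. (\<integral>\<omega>'. \<Psi> (x, B \<omega>') \<partial>M) \<partial>distr M S A)"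
    by (intro Bochner_Integration.integral_cong refl integral_distr) auto
  also have "\<dots> = (\<integral>\<omega>. (\<integral>\<omega>'. \<Psi> (A \<omega>, B \<omega>') \<partial>M) \<partial>M)"
    by (rule integral_distr) measurable
  finally show ?thesis
    unfolding distr_pair by (subst (asm) integral_distr) auto
qed

end

section \<open>Gaussian averages\<close>

definition normal_expectation :: "(real \<Rightarrow> 'b::{banach, second_countable_topology}) \<Rightarrow> real \<Rightarrow> real \<Rightarrow> 'b" where
  "normal_expectation F m \<sigma> = (\<integral>z. std_normal_density z *\<^sub>R F (m + \<sigma> * z) \<partial>lborel)"

lemma normal_expectation_0 [simp]: "normal_expectation F m 0 = F m"
  by (simp add: normal_expectation_def)

lemma normal_expectation_shift: "normal_expectation (\<lambda>z. F (m + c * z)) 0 \<sigma> = normal_expectation F m (c * \<sigma>)"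
  by (simp add: normal_expectation_def mult.assoc)

lemma norm_std_normal_scaleR_le:
  assumes "norm y \<le> B"
  shows "norm (std_normal_density z *\<^sub>R y) \<le> B * std_normal_density z"
  using mult_right_mono[OF assms normal_density_nonneg[of 0 1 z]] by (simp add: mult.commute)

lemma norm_normal_expectation_le:
  assumes [measurable]: "F \<in> borel_measurable borel" and bound: "\<And>y. norm (F y) \<le> B"
  shows "norm (normal_expectation F m \<sigma>) \<le> B"
proof -
  have integrable: "integrable lborel (\<lambda>z. B * std_normal_density z)" by simp
  have "norm (normal_expectation F m \<sigma>) \<le> (\<integral>z. B * std_normal_density z \<partial>lborel)"
    unfolding normal_expectation_def
  proof (rule Bochner_Integration.integral_norm_bound_integral[OF _ integrable])
    show "integrable lborel (\<lambda>z. std_normal_density z *\<^sub>R F (m + \<sigma> * z))"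
      by (rule Bochner_Integration.integrable_bound[OF integrable])
        (auto intro!: AE_I2 borel_measurable_scaleR
          order_trans[OF norm_std_normal_scaleR_le[OF bound]] simp del: norm_scaleR)
  qed (rule norm_std_normal_scaleR_le[OF bound])
  thus ?thesis by simp
qed

lemma bounded_normal_expectation:
  assumes "F \<in> borel_measurable borel" and "bounded (range F)"
  shows "bounded (range (\<lambda>x. normal_expectation F (m x) (\<sigma> x)))"
proof -
  obtain B where "\<And>y. norm (F y) \<le> B"
    using assms(2) by (auto simp: bounded_iff)
  with assms(1) show ?thesis
    by (auto simp: bounded_iff intro!: exI[of _ B] norm_normal_expectation_le)
qed

lemma continuous_on_normal_expectation:
  assumes cont: "continuous_on UNIV F" and bound: "bounded (range F)"
  shows "continuous_on UNIV (\<lambda>(m, \<sigma>). normal_expectation F m \<sigma>)"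
proof (rule continuous_on_sequentiallyI)
  fix u :: "nat \<Rightarrow> real \<times> real" and p assume limit: "u \<longlonglongrightarrow> p"
  have [measurable]: "F \<in> borel_measurable borel" by (rule borel_measurable_continuous_onI[OF cont])
  obtain B where F_bound: "\<And>y. norm (F y) \<le> B"
    using bound by (auto simp: bounded_iff)
  have "(\<lambda>n. normal_expectation F (fst (u n)) (snd (u n))) \<longlonglongrightarrow> normal_expectation F (fst p) (snd p)"
    unfolding normal_expectation_def
  proof (rule integral_dominated_convergence[where w = "\<lambda>z. B * std_normal_density z"])
    show "AE z in lborel. (\<lambda>n. std_normal_density z *\<^sub>R F (fst (u n) + snd (u n) * z))
        \<longlonglongrightarrow> std_normal_density z *\<^sub>R F (fst p + snd p * z)"
      by (intro AE_I2 tendsto_intros continuous_on_tendsto_compose[OF cont] limit) auto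
    show "AE z in lborel. norm (std_normal_density z *\<^sub>R F (fst (u n) + snd (u n) * z))
        \<le> B * std_normal_density z" for n
      by (intro AE_I2 norm_std_normal_scaleR_le F_bound)
  qed (auto intro!: borel_measurable_scaleR)
  thus "(\<lambda>n. case u n of (m, \<sigma>) \<Rightarrow> normal_expectation F m \<sigma>) \<longlonglongrightarrow> (case p of (m, \<sigma>) \<Rightarrow> normal_expectation F m \<sigma>)"
    by (simp add: case_prod_unfold)
qed

lemma (in prob_space) expectation_normal_distributed:
  assumes Z_normal: "distributed M lborel Z (normal_density m \<sigma>)" and \<sigma>_pos: "0 < \<sigma>"
    and [measurable]: "F \<in> borel_measurable borel"
  shows "(\<integral>\<omega>. F (Z \<omega>) \<partial>M) = normal_expectation F m \<sigma>"
proof -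
  define U where "U = (\<lambda>\<omega>. (Z \<omega> - m) / \<sigma>)"
  have U_standard: "distributed M lborel U std_normal_density"
    using Z_normal unfolding U_def by (subst normal_standard_normal_convert[OF \<sigma>_pos, symmetric])
  have [measurable]: "U \<in> borel_measurable M"
    using distributed_measurable[OF U_standard] by simp
  have "(\<integral>\<omega>. F (m + \<sigma> * U \<omega>) \<partial>M) = (\<integral>z. F (m + \<sigma> * z) \<partial>distr M lborel U)"
    by (rule integral_distr[symmetric]) auto
  also have "distr M lborel U = density lborel std_normal_density"
    by (rule distributed_distr_eq_density[OF U_standard])
  also have "(\<integral>z. F (m + \<sigma> * z) \<partial>density lborel std_normal_density) = normal_expectation F m \<sigma>"
    unfolding normal_expectation_def by (rule integral_density) auto
  finally show ?thesis using \<sigma>_pos by (simp add: U_def)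
qed

section \<open>Wiener integrals\<close>

locale brownian = prob_space M for M :: "'a measure" +
  fixes W :: "real \<Rightarrow> 'a \<Rightarrow> real"
  assumes W_brownian: "brownian_motion M W"
begin

lemma W_measurable: "0 \<le> t \<Longrightarrow> W t \<in> borel_measurable M"
  using W_brownian by (simp add: brownian_motion_def)

lemma AE_continuous_path: "AE \<omega> in M. continuous_on {0..} (\<lambda>t. W t \<omega>)"
  using W_brownian by (auto simp: brownian_motion_def)

lemma increment_distributed:
  "0 \<le> s \<Longrightarrow> s < t \<Longrightarrow> distributed M lborel (\<lambda>\<omega>. W t \<omega> - W s \<omega>) (normal_density 0 (sqrt (t - s)))"
  using W_brownian by (simp add: brownian_motion_def)

lemma increments_indep:
  assumes "0 \<le> ts 0" "\<And>i. i < k \<Longrightarrow> ts i \<le> ts (Suc i)"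
  shows "indep_vars (\<lambda>_. borel) (\<lambda>i \<omega>. W (ts (Suc i)) \<omega> - W (ts i) \<omega>) {..<k}"
  using W_brownian assms unfolding brownian_motion_def by blast

definition wiener_sum :: "(real \<Rightarrow> real) \<Rightarrow> real \<Rightarrow> real \<Rightarrow> nat \<Rightarrow> 'a \<Rightarrow> real" where
  "wiener_sum g r s N \<omega> = stieltjes_sum g (\<lambda>u. W u \<omega>) r s N"

definition wiener_integral :: "(real \<Rightarrow> real) \<Rightarrow> real \<Rightarrow> real \<Rightarrow> 'a \<Rightarrow> real" where
  "wiener_integral g r s \<omega> = stieltjes_integral g (\<lambda>u. W u \<omega>) r s"

lemma wiener_sum_measurable:
  assumes "0 \<le> r" "r \<le> s"
  shows "wiener_sum g r s N \<in> borel_measurable M"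
proof -
  have "0 \<le> grid r s N k" for k
    using grid_mono[of r s 0 k N] assms by simp
  thus ?thesis unfolding wiener_sum_def stieltjes_sum_def
    by (intro borel_measurable_sum borel_measurable_times borel_measurable_diff W_measurable) auto
qed

lemma wiener_integral_measurable:
  assumes "0 \<le> r" "r \<le> s"
  shows "wiener_integral g r s \<in> borel_measurable M"
  unfolding wiener_integral_def stieltjes_integral_def
  by (intro borel_measurable_lim_metric wiener_sum_measurable[OF assms, unfolded wiener_sum_def])

lemma AE_wiener_sum_tendsto:
  assumes "0 \<le> r" "r \<le> s" and g_C1: "g C1_differentiable_on {r..s}"
  shows "AE \<omega> in M. (\<lambda>N. wiener_sum g r s N \<omega>) \<longlonglongrightarrow> wiener_integral g r s \<omega>"
  using AE_continuous_path
proof eventually_elim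
  case (elim \<omega>)
  hence "continuous_on {r..s} (\<lambda>t. W t \<omega>)"
    by (rule continuous_on_subset) (use assms in auto)
  from stieltjes_sum_tendsto_integral[OF \<open>r \<le> s\<close> g_C1 this] show ?case
    by (simp add: wiener_sum_def wiener_integral_def)
qed

lemma indep_vars_wiener_sums:
  assumes times: "0 \<le> \<tau> 0" "\<And>k. k < m \<Longrightarrow> \<tau> k \<le> \<tau> (Suc k)" and "0 < N"
  shows "indep_vars (\<lambda>_. borel) (\<lambda>k. wiener_sum (g k) (\<tau> k) (\<tau> (Suc k)) N) {..<m}"
proof -
  let ?t = "concat_grid \<tau> N"
  define Z where "Z = (\<lambda>i \<omega>. W (?t (Suc i)) \<omega> - W (?t i) \<omega>)"
  define block where "block = (\<lambda>k. {k * N..<Suc k * N})"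
  define weighted where "weighted = (\<lambda>k z. \<Sum>l<N. g k (?t (k * N + l)) * z (k * N + l))"
  have block_sub: "block k \<subseteq> {..<m * N}" if "k \<in> {..<m}" for k
    using that mult_le_mono1[of "Suc k" m N] by (auto simp: block_def)
  have block_disj: "disjoint_family_on block {..<m}"
    unfolding disjoint_family_on_def block_def
    by (metis (no_types, lifting) \<open>0 < N\<close> atLeastLessThan_iff disjoint_iff div_nat_eqI mult.commute)
  have "indep_vars (\<lambda>_. borel) Z {..<m * N}"
    unfolding Z_def using times \<open>0 < N\<close> concat_grid_eq_grid[of N 0 \<tau> 0]
    by (intro increments_indep concat_grid_le_Suc) auto
  hence "indep_vars (\<lambda>k. PiM (block k) (\<lambda>_. borel)) (\<lambda>k \<omega>. \<lambda>i\<in>block k. Z i \<omega>) {..<m}"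
    by (rule indep_vars_restrict[OF _ block_sub block_disj])
  hence "indep_vars (\<lambda>_. borel) (\<lambda>k \<omega>. weighted k (\<lambda>i\<in>block k. Z i \<omega>)) {..<m}"
    by (rule indep_vars_compose2)
       (auto simp: weighted_def block_def intro!: borel_measurable_sum borel_measurable_times)
  moreover have "(\<lambda>\<omega>. weighted k (\<lambda>i\<in>block k. Z i \<omega>)) = wiener_sum (g k) (\<tau> k) (\<tau> (Suc k)) N" for k
    unfolding wiener_sum_def stieltjes_sum_def weighted_def Z_def block_def
    using concat_grid_eq_grid[OF \<open>0 < N\<close>, of _ \<tau> k] concat_grid_eq_grid[OF \<open>0 < N\<close>, of "Suc _" \<tau> k]
    by (intro ext sum.cong refl) auto
  ultimately show ?thesis by simp
qed

lemma indep_vars_wiener_integrals: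
  assumes times: "0 \<le> \<tau> 0" "\<And>k. k < m \<Longrightarrow> \<tau> k \<le> \<tau> (Suc k)"
    and g_C1: "\<And>k. k < m \<Longrightarrow> g k C1_differentiable_on {\<tau> k..\<tau> (Suc k)}"
  shows "indep_vars (\<lambda>_. borel) (\<lambda>k. wiener_integral (g k) (\<tau> k) (\<tau> (Suc k))) {..<m}"
proof (rule indep_vars_LIMSEQ[where Y = "\<lambda>N k. wiener_sum (g k) (\<tau> k) (\<tau> (Suc k)) (Suc N)"])
  have nonneg: "0 \<le> \<tau> k" if "k \<le> m" for k
    using that by (induction k) (use times in \<open>auto intro: order_trans\<close>)
  fix k assume "k \<in> {..<m}"
  hence interval: "0 \<le> \<tau> k" "\<tau> k \<le> \<tau> (Suc k)" "g k C1_differentiable_on {\<tau> k..\<tau> (Suc k)}"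
    using nonneg times(2) g_C1 by auto
  show "wiener_integral (g k) (\<tau> k) (\<tau> (Suc k)) \<in> borel_measurable M"
    by (rule wiener_integral_measurable[OF interval(1,2)])
  show "AE \<omega> in M. (\<lambda>N. wiener_sum (g k) (\<tau> k) (\<tau> (Suc k)) (Suc N) \<omega>)
      \<longlonglongrightarrow> wiener_integral (g k) (\<tau> k) (\<tau> (Suc k)) \<omega>"
    using AE_wiener_sum_tendsto[OF interval] by eventually_elim (rule LIMSEQ_Suc)
qed (use indep_vars_wiener_sums[OF times] in auto)

lemma wiener_sum_distributed:
  assumes interval: "0 \<le> r" "r < s" and N_pos: "0 < N" and g_nonzero: "\<And>u. u \<in> {r..s} \<Longrightarrow> g u \<noteq> 0"
  shows "distributed M lborel (wiener_sum g r s N)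
      (normal_density 0 (sqrt (stieltjes_sum (\<lambda>u. (g u)\<^sup>2) (\<lambda>u. u) r s N)))"
proof -
  let ?t = "grid r s N"
  define \<sigma> where "\<sigma> = (\<lambda>k. \<bar>g (?t k)\<bar> * sqrt (?t (Suc k) - ?t k))"
  have grid_less: "?t k < ?t (Suc k)" for k
    using divide_pos_pos[of "s - r" "real N"] interval N_pos unfolding grid_Suc_diff[of r s N k, symmetric] by simp
  have grid_nonneg: "0 \<le> ?t k" for k
    using grid_mono[of r s 0 k N] interval by simp
  have weight_nonzero: "g (?t k) \<noteq> 0" if "k < N" for k
    using that interval by (intro g_nonzero grid_in) auto
  have "indep_vars (\<lambda>_. borel) (\<lambda>k \<omega>. W (?t (Suc k)) \<omega> - W (?t k) \<omega>) {..<N}"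
    using interval grid_less by (intro increments_indep) (auto intro: less_imp_le)
  hence indep: "indep_vars (\<lambda>_. borel) (\<lambda>k \<omega>. g (?t k) * (W (?t (Suc k)) \<omega> - W (?t k) \<omega>)) {..<N}"
    by (rule indep_vars_compose2) auto
  have "distributed M lborel (\<lambda>\<omega>. g (?t k) * (W (?t (Suc k)) \<omega> - W (?t k) \<omega>)) (normal_density 0 (\<sigma> k))"
    if "k < N" for k
    using normal_density_affine[OF increment_distributed[OF grid_nonneg grid_less], of k "g (?t k)" 0]
      grid_less weight_nonzero[OF that]
    by (simp add: \<sigma>_def)
  hence "distributed M lborel (\<lambda>\<omega>. \<Sum>k<N. g (?t k) * (W (?t (Suc k)) \<omega> - W (?t k) \<omega>))
     (normal_density (\<Sum>k<N. 0) (sqrt (\<Sum>k<N. (\<sigma> k)\<^sup>2)))"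
    using N_pos grid_less weight_nonzero by (intro sum_indep_normal indep) (auto simp: \<sigma>_def)
  moreover have "(\<sigma> k)\<^sup>2 = (g (?t k))\<^sup>2 * (?t (Suc k) - ?t k)" for k
    using grid_less[of k] by (simp add: \<sigma>_def power_mult_distrib)
  ultimately show ?thesis
    by (simp add: wiener_sum_def[abs_def] stieltjes_sum_def)
qed

lemma expectation_wiener_sum:
  assumes interval: "0 \<le> r" "r < s" and N_pos: "0 < N" and g_nonzero: "\<And>u. u \<in> {r..s} \<Longrightarrow> g u \<noteq> 0"
    and F_measurable: "F \<in> borel_measurable borel"
  shows "(\<integral>\<omega>. F (wiener_sum g r s N \<omega>) \<partial>M)
    = normal_expectation F 0 (sqrt (stieltjes_sum (\<lambda>u. (g u)\<^sup>2) (\<lambda>u. u) r s N))"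
proof (rule expectation_normal_distributed[OF wiener_sum_distributed[OF interval N_pos g_nonzero] _ F_measurable])
  have "g (grid r s N k) \<noteq> 0" if "k < N" for k
    using that interval by (intro g_nonzero grid_in) auto
  hence "0 < stieltjes_sum (\<lambda>u. (g u)\<^sup>2) (\<lambda>u. u) r s N"
    unfolding stieltjes_sum_def grid_Suc_diff using interval N_pos by (intro sum_pos) auto
  thus "0 < sqrt (stieltjes_sum (\<lambda>u. (g u)\<^sup>2) (\<lambda>u. u) r s N)" by simp
qed

lemma expectation_wiener_integral:
  assumes interval: "0 \<le> r" "r \<le> s" and weight: "g C1_differentiable_on {r..s}" "\<And>u. u \<in> {r..s} \<Longrightarrow> g u \<noteq> 0"
    and cont: "continuous_on UNIV F" and bound: "bounded (range F)"
  shows "(\<integral>\<omega>. F (wiener_integral g r s \<omega>) \<partial>M)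
    = normal_expectation F 0 (sqrt (integral {r..s} (\<lambda>u. (g u)\<^sup>2)))"
proof (cases "r = s")
  case True
  thus ?thesis
    by (simp add: wiener_integral_def stieltjes_integral_def lim_const prob_space
        stieltjes_sum_degenerate[THEN ext])
next
  case False
  let ?V = "\<lambda>N. stieltjes_sum (\<lambda>u. (g u)\<^sup>2) (\<lambda>u. u) r s N"
  have F_measurable [measurable]: "F \<in> borel_measurable borel" by (rule borel_measurable_continuous_onI[OF cont])
  note [measurable] = wiener_integral_measurable[OF interval] wiener_sum_measurable[OF interval]
  obtain B where F_bound: "\<And>y. norm (F y) \<le> B"
    using bound by (auto simp: bounded_iff)
  have lim_sum: "(\<lambda>N. \<integral>\<omega>. F (wiener_sum g r s N \<omega>) \<partial>M) \<longlonglongrightarrow> (\<integral>\<omega>. F (wiener_integral g r s \<omega>) \<partial>M)"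
  proof (rule integral_dominated_convergence[where w = "\<lambda>_. B"])
    from AE_wiener_sum_tendsto[OF interval weight(1)]
    show "AE \<omega> in M. (\<lambda>N. F (wiener_sum g r s N \<omega>)) \<longlonglongrightarrow> F (wiener_integral g r s \<omega>)"
      by eventually_elim (rule continuous_on_tendsto_compose[OF cont], auto)
  qed (auto simp: F_bound)
  have "(\<lambda>N. normal_expectation F 0 (sqrt (?V N)))
      \<longlonglongrightarrow> normal_expectation F 0 (sqrt (integral {r..s} (\<lambda>u. (g u)\<^sup>2)))"
  proof -
    have "(\<lambda>u. (g u)\<^sup>2) C1_differentiable_on {r..s}"
      using weight(1) by (simp add: power2_eq_square)
    hence "(\<lambda>N. (0, sqrt (?V N))) \<longlonglongrightarrow> (0, sqrt (integral {r..s} (\<lambda>u. (g u)\<^sup>2)))"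
      by (intro tendsto_intros stieltjes_sum_id_tendsto interval)
    from continuous_on_tendsto_compose[OF continuous_on_normal_expectation[OF cont bound] this]
    show ?thesis by simp
  qed
  moreover have "\<forall>\<^sub>F N in sequentially. normal_expectation F 0 (sqrt (?V N)) = (\<integral>\<omega>. F (wiener_sum g r s N \<omega>) \<partial>M)"
    using eventually_gt_at_top[of 0]
    by eventually_elim (use interval False expectation_wiener_sum[OF interval(1) _ _ weight(2) F_measurable] in auto)
  ultimately show ?thesis
    by (rule LIMSEQ_unique[OF lim_sum Lim_transform_eventually])
qed

end

section \<open>Differentiation under the integral sign\<close>

lemma has_vector_derivative_iff_quotient:
  fixes g :: "real \<Rightarrow> 'a::real_normed_vector"
  shows "(g has_vector_derivative D) (at x) \<longleftrightarrow> ((\<lambda>t. (g t - g x) /\<^sub>R (t - x)) \<longlongrightarrow> D) (at x)"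
proof -
  have "(g has_vector_derivative D) (at x) \<longleftrightarrow>
      ((\<lambda>t. norm (g t - g x - (t - x) *\<^sub>R D) / norm (t - x)) \<longlongrightarrow> 0) (at x)"
    unfolding has_vector_derivative_def has_derivative_iff_norm
    by (simp add: bounded_linear_scaleR_left)
  also have "\<dots> \<longleftrightarrow> ((\<lambda>t. norm ((g t - g x) /\<^sub>R (t - x) - D)) \<longlongrightarrow> 0) (at x)"
  proof (rule tendsto_cong)
    have "norm (g t - g x - (t - x) *\<^sub>R D) / norm (t - x) = norm ((g t - g x) /\<^sub>R (t - x) - D)"
      if "t \<noteq> x" for t
    proof -
      have "(g t - g x) /\<^sub>R (t - x) - D = (g t - g x - (t - x) *\<^sub>R D) /\<^sub>R (t - x)"
        using that by (simp add: scaleR_diff_right)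
      thus ?thesis by (simp add: divide_inverse mult.commute)
    qed
    thus "\<forall>\<^sub>F t in at x. norm (g t - g x - (t - x) *\<^sub>R D) / norm (t - x) = norm ((g t - g x) /\<^sub>R (t - x) - D)"
      by (auto simp: eventually_at_filter)
  qed
  also have "\<dots> \<longleftrightarrow> ((\<lambda>t. (g t - g x) /\<^sub>R (t - x)) \<longlongrightarrow> D) (at x)"
    by (simp add: tendsto_norm_zero_iff LIM_zero_iff)
  finally show ?thesis .
qed

lemma norm_quotient_le_vector_derivative:
  fixes g :: "real \<Rightarrow> 'a::real_normed_vector"
  assumes segment: "convex S" "t \<in> S" "x \<in> S" "t \<noteq> x"
    and deriv: "\<And>s. s \<in> S \<Longrightarrow> (g has_vector_derivative g' s) (at s)"
    and bound: "\<And>s. s \<in> S \<Longrightarrow> norm (g' s) \<le> B"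
  shows "norm ((g t - g x) /\<^sub>R (t - x)) \<le> B"
proof -
  have "norm (g t - g x) \<le> B * norm (t - x)"
  proof (rule differentiable_bound[OF segment(1) _ _ segment(2,3)])
    show "(g has_derivative (\<lambda>h. h *\<^sub>R g' s)) (at s within S)" if "s \<in> S" for s
      using deriv[OF that] unfolding has_vector_derivative_def by (rule has_derivative_at_withinI)
    show "onorm (\<lambda>h. h *\<^sub>R g' s) \<le> B" if "s \<in> S" for s
      using bound[OF that] by (intro onorm_le) (simp add: mult.commute[of B] mult_left_mono)
  qed
  thus ?thesis using segment(4) by (simp only: norm_scaleR) (simp add: divide_simps)
qed

lemma has_vector_derivative_lebesgue_integral:
  fixes g g' :: "real \<Rightarrow> 'b \<Rightarrow> 'c::{banach, second_countable_topology}"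
  assumes neighbourhood: "open S" "convex S" "x \<in> S"
    and deriv: "\<And>t y. t \<in> S \<Longrightarrow> y \<in> space M \<Longrightarrow> ((\<lambda>t. g t y) has_vector_derivative g' t y) (at t)"
    and integrable: "\<And>t. t \<in> S \<Longrightarrow> integrable M (g t)"
    and measurable_deriv: "g' x \<in> borel_measurable M"
    and bound: "\<And>t y. t \<in> S \<Longrightarrow> y \<in> space M \<Longrightarrow> norm (g' t y) \<le> B y"
    and integrable_bound: "integrable M B"
  shows "((\<lambda>t. integral\<^sup>L M (g t)) has_vector_derivative integral\<^sup>L M (g' x)) (at x)"
proof -
  have "((\<lambda>t. (integral\<^sup>L M (g t) - integral\<^sup>L M (g x)) /\<^sub>R (t - x)) \<longlongrightarrow> integral\<^sup>L M (g' x)) (at x within S)"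
    unfolding tendsto_at_iff_sequentially comp_def
  proof (intro allI impI)
    fix X :: "nat \<Rightarrow> real" assume X_in: "\<forall>i. X i \<in> S - {x}" and X_tendsto: "X \<longlonglongrightarrow> x"
    have "(\<lambda>i. \<integral>y. (g (X i) y - g x y) /\<^sub>R (X i - x) \<partial>M) \<longlonglongrightarrow> integral\<^sup>L M (g' x)"
    proof (rule integral_dominated_convergence[where w = B])
      show "(\<lambda>y. (g (X i) y - g x y) /\<^sub>R (X i - x)) \<in> borel_measurable M" for i
        using X_in integrable neighbourhood
          by (intro borel_measurable_scaleR borel_measurable_diff borel_measurable_integrable) auto
      show "AE y in M. (\<lambda>i. (g (X i) y - g x y) /\<^sub>R (X i - x)) \<longlonglongrightarrow> g' x y"
      proof (rule AE_I2)
        fix y assume "y \<in> space M"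
        from deriv[OF neighbourhood(3) this] X_in X_tendsto show "(\<lambda>i. (g (X i) y - g x y) /\<^sub>R (X i - x)) \<longlonglongrightarrow> g' x y"
          unfolding has_vector_derivative_iff_quotient tendsto_at_iff_sequentially comp_def by auto
      qed
      show "AE y in M. norm ((g (X i) y - g x y) /\<^sub>R (X i - x)) \<le> B y" for i
        using X_in neighbourhood deriv bound by (intro AE_I2 norm_quotient_le_vector_derivative[where S = S]) auto
    qed (use measurable_deriv integrable_bound in auto)
    moreover have "(\<integral>y. (g (X i) y - g x y) /\<^sub>R (X i - x) \<partial>M)
        = (integral\<^sup>L M (g (X i)) - integral\<^sup>L M (g x)) /\<^sub>R (X i - x)" for i
      using X_in neighbourhood integrable by (simp add: Bochner_Integration.integral_diff)
    ultimately show "(\<lambda>i. (integral\<^sup>L M (g (X i)) - integral\<^sup>L M (g x)) /\<^sub>R (X i - x)) \<longlonglongrightarrow> integral\<^sup>L M (g' x)"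
      by (simp only:)
  qed
  thus ?thesis
    by (simp add: has_vector_derivative_iff_quotient at_within_open[OF neighbourhood(3,1)])
qed

section \<open>Gaussian convolutions\<close>

text \<open>
  \<open>gauss_kernel k v\<close> is \<open>(-1)\<^sup>k\<close> times the \<open>k\<close>-th derivative of the density of \<open>N(0, v)\<close>; the
  recursion is that of the Hermite polynomials. The truncated \<open>k - 1\<close> is harmless: at \<open>k = 0\<close> its
  coefficient vanishes.
\<close>
fun gauss_kernel :: "nat \<Rightarrow> real \<Rightarrow> real \<Rightarrow> real" where
  "gauss_kernel 0 v z = normal_density 0 (sqrt v) z"
| "gauss_kernel (Suc k) v z = (z * gauss_kernel k v z - real k * gauss_kernel (k - 1) v z) / v"

lemma gauss_kernel_measurable [measurable]: "gauss_kernel k v \<in> borel_measurable borel"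
proof (induction k rule: less_induct)
  case (less k)
  thus ?case by (cases k) (auto simp: gauss_kernel.simps[abs_def])
qed

lemma continuous_on_gauss_kernel: "continuous_on ({0<..} \<times> UNIV) (\<lambda>(v, z). gauss_kernel k v z)"
proof (induction k rule: less_induct)
  case (less k)
  thus ?case
    by (cases k) (auto simp: case_prod_unfold normal_density_def intro!: continuous_intros)
qed

lemma normal_density_has_derivative:
  assumes v_deriv: "(v has_real_derivative v') (at t)" and z_deriv: "(z has_real_derivative z') (at t)"
    and v_pos: "0 < v t"
  shows "((\<lambda>t. normal_density 0 (sqrt (v t)) (z t)) has_real_derivative
    v' / 2 * gauss_kernel 2 (v t) (z t) - z' * gauss_kernel 1 (v t) (z t)) (at t)"
proof -
  have scale: "((\<lambda>t. 1 / sqrt (2 * pi * v t)) has_real_derivative - v' / (2 * v t) * (1 / sqrt (2 * pi * v t))) (at t)"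
    using v_pos by (auto intro!: derivative_eq_intros v_deriv simp: real_sqrt_mult field_simps)
  have expo: "((\<lambda>t. exp (- (z t)\<^sup>2 / (2 * v t))) has_real_derivative
      (v' * (z t)\<^sup>2 / (2 * (v t)\<^sup>2) - z' * z t / v t) * exp (- (z t)\<^sup>2 / (2 * v t))) (at t)"
    using v_pos by (auto intro!: derivative_eq_intros v_deriv z_deriv simp: field_simps power2_eq_square)
  have pos_near: "\<forall>\<^sub>F s in nhds t. 0 < v s"
    using DERIV_isCont[OF v_deriv] v_pos
      by (auto simp: isCont_def intro: order_tendstoD(1) dest: tendsto_at_iff_tendsto_nhds[THEN iffD1])
  have "((\<lambda>t. 1 / sqrt (2 * pi * v t) * exp (- (z t)\<^sup>2 / (2 * v t))) has_real_derivative
      v' / 2 * gauss_kernel 2 (v t) (z t) - z' * gauss_kernel 1 (v t) (z t)) (at t)"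
    using DERIV_mult[OF scale expo]
    by (rule DERIV_cong) (use v_pos in \<open>simp add: numeral_2_eq_2 normal_density_def field_simps\<close>)
  moreover have "\<forall>\<^sub>F s in nhds t. normal_density 0 (sqrt (v s)) (z s)
      = 1 / sqrt (2 * pi * v s) * exp (- (z s)\<^sup>2 / (2 * v s))"
    using pos_near by eventually_elim (simp add: normal_density_def)
  ultimately show ?thesis
    by (subst DERIV_cong_ev[OF refl _ refl])
qed

lemma gauss_kernel_has_derivative:
  assumes v_deriv: "(v has_real_derivative v') (at t)" and z_deriv: "(z has_real_derivative z') (at t)"
    and v_pos: "0 < v t"
  shows "((\<lambda>t. gauss_kernel k (v t) (z t)) has_real_derivative
    v' / 2 * gauss_kernel (k + 2) (v t) (z t) - z' * gauss_kernel (k + 1) (v t) (z t)) (at t)"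
proof (induction k rule: less_induct)
  case (less k)
  let ?K = "\<lambda>k. gauss_kernel k (v t) (z t)"
  show ?case
  proof (cases k)
    case 0
    thus ?thesis using normal_density_has_derivative[OF assms] by (simp add: numeral_2_eq_2)
  next
    case (Suc j)
    have deriv_j: "((\<lambda>t. gauss_kernel j (v t) (z t)) has_real_derivative
        v' / 2 * ?K (j + 2) - z' * ?K (j + 1)) (at t)"
      using less[of j] Suc by simp
    have deriv_pred: "((\<lambda>t. real j * gauss_kernel (j - 1) (v t) (z t)) has_real_derivative
        real j * (v' / 2 * ?K (j + 1) - z' * ?K j)) (at t)"
      using DERIV_cmult[OF less[of "j - 1"], of "real j"] Suc by (cases j) simp_all
    have recursion: "?K (j + 1) = (z t * ?K j - real j * ?K (j - 1)) / v t"
        "?K (j + 2) = (z t * ?K (j + 1) - (real j + 1) * ?K j) / v t"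
        "?K (j + 3) = (z t * ?K (j + 2) - (real j + 2) * ?K (j + 1)) / v t"
      by (simp_all add: numeral_2_eq_2 numeral_3_eq_3)
    have quotient_rule: "(((z' * ?K j + (v' / 2 * ?K (j + 2) - z' * ?K (j + 1)) * z t)
          - real j * (v' / 2 * ?K (j + 1) - z' * ?K j)) * v t
        - (z t * ?K j - real j * ?K (j - 1)) * v') / (v t * v t)
      = v' / 2 * ?K (j + 3) - z' * ?K (j + 2)"
      unfolding recursion using v_pos by (simp add: field_simps del: gauss_kernel.simps)
    have "((\<lambda>t. (z t * gauss_kernel j (v t) (z t) - real j * gauss_kernel (j - 1) (v t) (z t)) / v t)
        has_real_derivative v' / 2 * ?K (j + 3) - z' * ?K (j + 2)) (at t)"
      using DERIV_divide[OF DERIV_diff[OF DERIV_mult[OF z_deriv deriv_j] deriv_pred] v_deriv]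
        v_pos unfolding quotient_rule by simp
    thus ?thesis by (simp add: Suc numeral_2_eq_2 numeral_3_eq_3)
  qed
qed

lemma gauss_kernel_scaleR_has_vector_derivative:
  assumes "(v has_real_derivative v') (at t)" and "(m has_real_derivative m') (at t)" and "0 < v t"
  shows "((\<lambda>t. gauss_kernel k (v t) (y - m t) *\<^sub>R z) has_vector_derivative
    (v' / 2) *\<^sub>R gauss_kernel (k + 2) (v t) (y - m t) *\<^sub>R z
    + m' *\<^sub>R gauss_kernel (k + 1) (v t) (y - m t) *\<^sub>R z) (at t)"
proof -
  have "((\<lambda>t. y - m t) has_real_derivative - m') (at t)"
    using assms(2) by (auto intro!: derivative_eq_intros)
  from gauss_kernel_has_derivative[OF assms(1) this assms(3), of k]
  have "((\<lambda>t. gauss_kernel k (v t) (y - m t)) has_real_derivative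
      v' / 2 * gauss_kernel (k + 2) (v t) (y - m t) - (- m') * gauss_kernel (k + 1) (v t) (y - m t)) (at t)" .
  from has_vector_derivative_scaleR[OF this has_vector_derivative_const, of z] show ?thesis
    by (simp add: scaleR_add_left del: gauss_kernel.simps)
qed

lemma normal_density_exp_bound:
  assumes a_pos: "0 < a" and v_in: "v \<in> {a..b}"
  shows "normal_density 0 (sqrt v) z \<le> exp (\<mu>\<^sup>2 * b / 2) / sqrt (2 * pi * a) * exp (- (\<mu> * \<bar>z\<bar>))"
proof -
  have v_range: "0 < v" "v \<le> b" using a_pos v_in by auto
  have "\<mu> * \<bar>z\<bar> - z\<^sup>2 / (2 * v) \<le> \<mu>\<^sup>2 * v / 2"
    using zero_le_power2[of "\<bar>z\<bar> - \<mu> * v"] v_range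
      by (simp add: field_simps power2_diff power_mult_distrib power2_eq_square)
  also have "\<dots> \<le> \<mu>\<^sup>2 * b / 2"
    using v_range by (simp add: mult_left_mono)
  finally have "exp (- z\<^sup>2 / (2 * v)) \<le> exp (\<mu>\<^sup>2 * b / 2) * exp (- (\<mu> * \<bar>z\<bar>))"
    by (simp add: exp_add[symmetric])
  moreover have "1 / sqrt (2 * pi * v) \<le> 1 / sqrt (2 * pi * a)"
    using a_pos v_in by (intro divide_left_mono) auto
  ultimately have "1 / sqrt (2 * pi * v) * exp (- z\<^sup>2 / (2 * v))
      \<le> 1 / sqrt (2 * pi * a) * (exp (\<mu>\<^sup>2 * b / 2) * exp (- (\<mu> * \<bar>z\<bar>)))"
    using a_pos by (intro mult_mono) auto
  thus ?thesis using v_range by (simp add: normal_density_def)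
qed

lemma gauss_kernel_exp_bound:
  assumes a_pos: "0 < a"
  shows "\<exists>C\<ge>0. \<forall>v\<in>{a..b}. \<forall>z. \<bar>gauss_kernel k v z\<bar> \<le> C * exp (- (\<mu> * \<bar>z\<bar>))"
proof (induction k arbitrary: \<mu> rule: less_induct)
  case (less k)
  show ?case
  proof (cases k)
    case 0
    thus ?thesis using normal_density_exp_bound[OF a_pos] a_pos
      by (intro exI[of _ "exp (\<mu>\<^sup>2 * b / 2) / sqrt (2 * pi * a)"]) auto
  next
    case (Suc j)
    obtain C where bound_j: "0 \<le> C" "\<And>v z. v \<in> {a..b} \<Longrightarrow> \<bar>gauss_kernel j v z\<bar> \<le> C * exp (- ((\<mu> + 1) * \<bar>z\<bar>))"
      using less[of j "\<mu> + 1"] Suc by blast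
    obtain D where bound_pred: "0 \<le> D" "\<And>v z. v \<in> {a..b} \<Longrightarrow> \<bar>gauss_kernel (j - 1) v z\<bar> \<le> D * exp (- (\<mu> * \<bar>z\<bar>))"
      using less[of "j - 1" \<mu>] Suc by (metis diff_le_self le_imp_less_Suc)
    have "\<bar>gauss_kernel (Suc j) v z\<bar> \<le> (C + real j * D) / a * exp (- (\<mu> * \<bar>z\<bar>))" if v_in: "v \<in> {a..b}" for v z
    proof -
      have "\<bar>z\<bar> \<le> exp \<bar>z\<bar>"
        using exp_ge_add_one_self[of "\<bar>z\<bar>"] by linarith
      hence "\<bar>z\<bar> * (C * exp (- ((\<mu> + 1) * \<bar>z\<bar>))) \<le> exp \<bar>z\<bar> * (C * exp (- ((\<mu> + 1) * \<bar>z\<bar>)))"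
        using bound_j(1) by (intro mult_right_mono) auto
      also have "\<dots> = C * exp (- (\<mu> * \<bar>z\<bar>))"
        by (simp add: exp_add[symmetric] algebra_simps)
      finally have "\<bar>z * gauss_kernel j v z\<bar> \<le> C * exp (- (\<mu> * \<bar>z\<bar>))"
        using mult_left_mono[OF bound_j(2)[OF v_in, of z] abs_ge_zero[of z]] by (simp add: abs_mult)
      moreover have "\<bar>real j * gauss_kernel (j - 1) v z\<bar> \<le> real j * (D * exp (- (\<mu> * \<bar>z\<bar>)))"
        using bound_pred(2)[OF v_in, of z] by (simp add: abs_mult mult_left_mono)
      ultimately have "\<bar>z * gauss_kernel j v z - real j * gauss_kernel (j - 1) v z\<bar>
          \<le> (C + real j * D) * exp (- (\<mu> * \<bar>z\<bar>))"
        by (simp add: distrib_right)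
      thus ?thesis
        using a_pos v_in bound_j(1) bound_pred(1) by (simp add: abs_divide) (intro frac_le, auto)
    qed
    thus ?thesis
      using a_pos bound_j(1) bound_pred(1) Suc by (intro exI[of _ "(C + real j * D) / a"]) auto
  qed
qed

lemma integrable_exp_neg_abs: "integrable lborel (\<lambda>y :: real. exp (- \<bar>y\<bar>))"
proof (rule Bochner_Integration.integrable_bound)
  interpret prob_space "density lborel (exponential_density 1)"
    by (rule prob_space_exponential_density) simp
  have "(\<integral>\<^sup>+ y. exponential_density 1 y \<partial>lborel) = 1"
    using emeasure_space_1 by (simp add: emeasure_density)
  hence integrable: "integrable lborel (exponential_density 1)"
    by (intro integrableI_nonneg) (auto simp: exponential_density_nonneg)
  moreover have "integrable lborel (\<lambda>y. exponential_density 1 (- y))"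
    using lborel_integrable_real_affine[OF integrable, of "-1" 0] by simp
  ultimately show "integrable lborel (\<lambda>y. exponential_density 1 y + exponential_density 1 (- y))"
    by (rule Bochner_Integration.integrable_add)
  show "AE y in lborel. norm (exp (- \<bar>y\<bar>)) \<le> norm (exponential_density 1 y + exponential_density 1 (- y))"
    by (intro AE_I2) (simp add: exponential_density_def)
qed measurable

definition gauss_conv :: "(real \<Rightarrow> 'b::{banach, second_countable_topology}) \<Rightarrow> nat \<Rightarrow> real \<Rightarrow> real \<Rightarrow> 'b" where
  "gauss_conv F k v m = (\<integral>y. gauss_kernel k v (y - m) *\<^sub>R F y \<partial>lborel)"

lemma normal_expectation_eq_gauss_conv:
  assumes \<sigma>_nonzero: "\<sigma> \<noteq> 0" and F_measurable: "F \<in> borel_measurable borel"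
  shows "normal_expectation F m \<sigma> = gauss_conv F 0 (\<sigma>\<^sup>2) m"
proof -
  have "gauss_conv F 0 (\<sigma>\<^sup>2) m
      = \<bar>\<sigma>\<bar> *\<^sub>R (\<integral>z. gauss_kernel 0 (\<sigma>\<^sup>2) (m + \<sigma> * z - m) *\<^sub>R F (m + \<sigma> * z) \<partial>lborel)"
    unfolding gauss_conv_def using \<sigma>_nonzero by (rule lborel_integral_real_affine)
  also have "\<dots> = (\<integral>z. \<bar>\<sigma>\<bar> *\<^sub>R (gauss_kernel 0 (\<sigma>\<^sup>2) (\<sigma> * z) *\<^sub>R F (m + \<sigma> * z)) \<partial>lborel)"
    by (subst integral_scaleR_right) simp
  also have "\<dots> = normal_expectation F m \<sigma>"
    unfolding normal_expectation_def using \<sigma>_nonzero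
    by (intro Bochner_Integration.integral_cong refl)
       (simp add: normal_density_def real_sqrt_mult power_mult_distrib)
  finally show ?thesis ..
qed

lemma gauss_kernel_bound_compact:
  assumes K_compact: "compact K" "K \<subseteq> {0<..} \<times> UNIV"
  obtains C where "0 \<le> C" "\<And>v m y. (v, m) \<in> K \<Longrightarrow> \<bar>gauss_kernel k v (y - m)\<bar> \<le> C * exp (- \<bar>y\<bar>)"
proof (cases "K = {}")
  case False
  obtain p where p_least: "p \<in> K" "\<And>q. q \<in> K \<Longrightarrow> fst p \<le> fst q"
    using continuous_attains_inf[OF K_compact(1) False continuous_on_fst[OF continuous_on_id]] by blast
  have "0 < fst p" using p_least(1) K_compact(2) by auto
  obtain R where norm_bound: "\<And>q. q \<in> K \<Longrightarrow> norm q \<le> R"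
    using continuous_on_compact_bound[OF K_compact(1) continuous_on_id] by blast
  obtain C where kernel_bound: "0 \<le> C"
    "\<And>v z. v \<in> {fst p..R} \<Longrightarrow> \<bar>gauss_kernel k v z\<bar> \<le> C * exp (- \<bar>z\<bar>)"
    using gauss_kernel_exp_bound[OF \<open>0 < fst p\<close>, of R k 1] by auto
  show thesis
  proof (rule that[of "C * exp R"])
    fix v m y assume in_K: "(v, m) \<in> K"
    have v_in: "v \<in> {fst p..R}" and m_le: "\<bar>m\<bar> \<le> R"
      using norm_bound[OF in_K] p_least(2)[OF in_K] norm_fst_le[of v m] norm_snd_le[of m v] by auto
    have "\<bar>gauss_kernel k v (y - m)\<bar> \<le> C * exp (- \<bar>y - m\<bar>)"
      by (rule kernel_bound(2)[OF v_in])
    also have "\<dots> \<le> C * exp (R - \<bar>y\<bar>)"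
      using kernel_bound(1) m_le by (intro mult_left_mono) auto
    finally show "\<bar>gauss_kernel k v (y - m)\<bar> \<le> C * exp R * exp (- \<bar>y\<bar>)"
      by (simp add: exp_diff exp_minus divide_inverse)
  qed (use kernel_bound(1) in simp)
qed (use that[of 0] in simp)

context
  fixes F :: "real \<Rightarrow> 'b::{banach, second_countable_topology}"
  assumes F_measurable [measurable]: "F \<in> borel_measurable borel" and F_bounded: "bounded (range F)"
begin

lemma gauss_conv_integrand_dominated:
  assumes K_compact: "compact K" "K \<subseteq> {0<..} \<times> UNIV"
  obtains w where "integrable lborel w"
    "\<And>v m y. (v, m) \<in> K \<Longrightarrow> norm (gauss_kernel k v (y - m) *\<^sub>R F y) \<le> w y"
proof -
  obtain C where kernel_bound: "0 \<le> C" "\<And>v m y. (v, m) \<in> K \<Longrightarrow> \<bar>gauss_kernel k v (y - m)\<bar> \<le> C * exp (- \<bar>y\<bar>)"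
    using gauss_kernel_bound_compact[OF K_compact] by blast
  obtain B where F_bound: "\<And>y. norm (F y) \<le> B"
    using F_bounded by (auto simp: bounded_iff)
  show thesis
  proof (rule that[of "\<lambda>y. C * exp (- \<bar>y\<bar>) * B"])
    show "integrable lborel (\<lambda>y. C * exp (- \<bar>y\<bar>) * B)"
      by (intro integrable_mult_left integrable_mult_right integrable_exp_neg_abs)
    show "norm (gauss_kernel k v (y - m) *\<^sub>R F y) \<le> C * exp (- \<bar>y\<bar>) * B" if "(v, m) \<in> K" for v m y
      unfolding norm_scaleR real_norm_def using kernel_bound that F_bound by (intro mult_mono) auto
  qed
qed

lemma integrable_gauss_conv:
  assumes "0 < v"
  shows "integrable lborel (\<lambda>y. gauss_kernel k v (y - m) *\<^sub>R F y)"
proof -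
  obtain w where dominated: "integrable lborel w" "\<And>y. norm (gauss_kernel k v (y - m) *\<^sub>R F y) \<le> w y"
    by (rule gauss_conv_integrand_dominated[of "{(v, m)}" k]) (use assms in auto)
  show ?thesis
    by (rule Bochner_Integration.integrable_bound[OF dominated(1)])
      (auto intro!: AE_I2 order_trans[OF dominated(2)] simp del: norm_scaleR)
qed

lemma continuous_on_gauss_conv: "continuous_on ({0<..} \<times> UNIV) (\<lambda>(v, m). gauss_conv F k v m)"
proof (rule continuous_on_sequentiallyI)
  fix u :: "nat \<Rightarrow> real \<times> real" and p
  assume u_in: "\<forall>n. u n \<in> {0<..} \<times> UNIV" and p_in: "p \<in> {0<..} \<times> (UNIV :: real set)" and u_tendsto: "u \<longlonglongrightarrow> p"
  have "compact (insert p (range u))" "insert p (range u) \<subseteq> {0<..} \<times> UNIV"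
    using compact_sequence_with_limit[OF u_tendsto] u_in p_in by blast+
  then obtain w where dominated: "integrable lborel w"
    "\<And>v m y. (v, m) \<in> insert p (range u) \<Longrightarrow> norm (gauss_kernel k v (y - m) *\<^sub>R F y) \<le> w y"
    by (rule gauss_conv_integrand_dominated[of _ k]) blast
  have "(\<lambda>n. gauss_conv F k (fst (u n)) (snd (u n))) \<longlonglongrightarrow> gauss_conv F k (fst p) (snd p)"
    unfolding gauss_conv_def
  proof (rule integral_dominated_convergence[OF _ _ dominated(1)])
    show "AE y in lborel. (\<lambda>n. gauss_kernel k (fst (u n)) (y - snd (u n)) *\<^sub>R F y)
        \<longlonglongrightarrow> gauss_kernel k (fst p) (y - snd p) *\<^sub>R F y"
    proof (intro AE_I2 tendsto_scaleR tendsto_const)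
      fix y
      have "(\<lambda>n. (fst (u n), y - snd (u n))) \<longlonglongrightarrow> (fst p, y - snd p)"
        by (intro tendsto_intros u_tendsto)
      from continuous_on_tendsto_compose[OF continuous_on_gauss_kernel this]
      show "(\<lambda>n. gauss_kernel k (fst (u n)) (y - snd (u n))) \<longlonglongrightarrow> gauss_kernel k (fst p) (y - snd p)"
        using u_in p_in by (simp add: mem_Times_iff)
    qed
    show "AE y in lborel. norm (gauss_kernel k (fst (u n)) (y - snd (u n)) *\<^sub>R F y) \<le> w y" for n
      by (intro AE_I2 dominated(2)) simp
  qed measurable
  thus "(\<lambda>n. case u n of (v, m) \<Rightarrow> gauss_conv F k v m) \<longlonglongrightarrow> (case p of (v, m) \<Rightarrow> gauss_conv F k v m)"
    by (simp add: case_prod_unfold)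
qed

lemma gauss_conv_integrand_dominated_on_curve:
  assumes S_compact: "compact S" and cont: "continuous_on S v" "continuous_on S m" "continuous_on S h"
    and v_pos: "\<And>t. t \<in> S \<Longrightarrow> 0 < v t"
  obtains w where "integrable lborel w"
    "\<And>t y. t \<in> S \<Longrightarrow> norm (h t *\<^sub>R gauss_kernel k (v t) (y - m t) *\<^sub>R F y) \<le> w y"
proof -
  have "compact ((\<lambda>t. (v t, m t)) ` S)" "(\<lambda>t. (v t, m t)) ` S \<subseteq> {0<..} \<times> UNIV"
    using S_compact cont v_pos by (auto intro!: compact_continuous_image continuous_on_Pair)
  then obtain w where kernel_dominated: "integrable lborel w"
    "\<And>t y. t \<in> S \<Longrightarrow> norm (gauss_kernel k (v t) (y - m t) *\<^sub>R F y) \<le> w y"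
    by (rule gauss_conv_integrand_dominated[of _ k]) blast
  obtain B where h_bound: "0 \<le> B" "\<And>t. t \<in> S \<Longrightarrow> norm (h t) \<le> B"
    using continuous_on_compact_bound[OF S_compact cont(3)] by blast
  show thesis
  proof (rule that[of "\<lambda>y. B * w y"])
    show "integrable lborel (\<lambda>y. B * w y)"
      by (intro integrable_mult_right kernel_dominated)
    show "norm (h t *\<^sub>R gauss_kernel k (v t) (y - m t) *\<^sub>R F y) \<le> B * w y" if "t \<in> S" for t y
      unfolding norm_scaleR[of "h t"] using h_bound kernel_dominated(2)[OF that] that by (intro mult_mono) auto
  qed
qed

lemma gauss_conv_has_vector_derivative:
  assumes neighbourhood: "open S" "x \<in> S"
    and v_deriv: "\<And>t. t \<in> S \<Longrightarrow> (v has_real_derivative v' t) (at t)"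
    and m_deriv: "\<And>t. t \<in> S \<Longrightarrow> (m has_real_derivative m' t) (at t)"
    and cont: "continuous_on S v'" "continuous_on S m'"
    and v_pos: "\<And>t. t \<in> S \<Longrightarrow> 0 < v t"
  shows "((\<lambda>t. gauss_conv F k (v t) (m t)) has_vector_derivative
      (v' x / 2) *\<^sub>R gauss_conv F (k + 2) (v x) (m x) + m' x *\<^sub>R gauss_conv F (k + 1) (v x) (m x)) (at x)"
proof -
  define g where "g = (\<lambda>k t y. gauss_kernel k (v t) (y - m t) *\<^sub>R F y)"
  define g' where "g' = (\<lambda>t y. (v' t / 2) *\<^sub>R g (k + 2) t y + m' t *\<^sub>R g (k + 1) t y)"
  obtain e where e_ball: "0 < e" "cball x e \<subseteq> S"
    using neighbourhood open_contains_cball by blast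
  have "continuous_on S v" "continuous_on S m"
    using v_deriv m_deriv by (meson continuous_at_imp_continuous_on DERIV_isCont)+
  note cont_cball = this[THEN continuous_on_subset, OF e_ball(2)] cont[THEN continuous_on_subset, OF e_ball(2)]
  have pos_cball: "0 < v t" if "t \<in> cball x e" for t
    using v_pos e_ball(2) that by auto
  note dominated = gauss_conv_integrand_dominated_on_curve[OF compact_cball cont_cball(1,2) _ pos_cball]
  obtain wv where dominated_v: "integrable lborel wv"
    "\<And>t y. t \<in> cball x e \<Longrightarrow> norm ((v' t / 2) *\<^sub>R g (k + 2) t y) \<le> wv y"
    unfolding g_def by (rule dominated[OF continuous_on_divide[OF cont_cball(3) continuous_on_const],
      of 2 "k + 2"]) auto
  obtain wm where dominated_m: "integrable lborel wm"
    "\<And>t y. t \<in> cball x e \<Longrightarrow> norm (m' t *\<^sub>R g (k + 1) t y) \<le> wm y"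
    unfolding g_def by (rule dominated[OF cont_cball(4), of "k + 1"]) auto
  have g_int: "integrable lborel (g j t)" if "t \<in> ball x e" for j t
    unfolding g_def by (intro integrable_gauss_conv pos_cball) (use that in auto)
  have "((\<lambda>t. integral\<^sup>L lborel (g k t)) has_vector_derivative integral\<^sup>L lborel (g' x)) (at x)"
  proof (rule has_vector_derivative_lebesgue_integral[where S = "ball x e" and B = "\<lambda>y. wv y + wm y"])
    show "g' x \<in> borel_measurable lborel"
      unfolding g'_def g_def by measurable
    fix t y assume "t \<in> ball x e"
    hence t_in: "t \<in> cball x e" "t \<in> S" using e_ball(2) by auto
    show "norm (g' t y) \<le> wv y + wm y"
      unfolding g'_def by (intro norm_triangle_mono dominated_v dominated_m t_in)
    show "((\<lambda>t. g k t y) has_vector_derivative g' t y) (at t)"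
      unfolding g_def g'_def by (intro gauss_kernel_scaleR_has_vector_derivative v_deriv m_deriv v_pos t_in)
  qed (use e_ball(1) g_int dominated_v dominated_m in auto)
  moreover have "integral\<^sup>L lborel (g' x)
      = (v' x / 2) *\<^sub>R integral\<^sup>L lborel (g (k + 2) x) + m' x *\<^sub>R integral\<^sup>L lborel (g (k + 1) x)"
    using g_int[of x] e_ball(1) unfolding g'_def by (simp add: Bochner_Integration.integral_add)
  ultimately show ?thesis
    unfolding g_def gauss_conv_def by simp
qed

end

section \<open>The Ornstein-Uhlenbeck semigroup\<close>

locale ou =
  fixes a b c :: real
begin

definition mean :: "real \<Rightarrow> real \<Rightarrow> real" where
  "mean h x = exp (b * h) * x + a * expm1_quot b h"

definition var :: "real \<Rightarrow> real" where
  "var h = c\<^sup>2 * expm1_quot (2 * b) h"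

definition semigroup :: "real \<Rightarrow> (real \<Rightarrow> 'b) \<Rightarrow> real \<Rightarrow> 'b::{banach, second_countable_topology}" where
  "semigroup h F x = normal_expectation F (mean h x) (c * sqrt (expm1_quot (2 * b) h))"

definition semigroup_deriv :: "nat \<Rightarrow> real \<Rightarrow> (real \<Rightarrow> 'b) \<Rightarrow> real \<Rightarrow> 'b::{banach, second_countable_topology}" where
  "semigroup_deriv k h F x = exp (b * h) ^ k *\<^sub>R gauss_conv F k (var h) (mean h x)"

lemma semigroup_0 [simp]: "semigroup 0 F x = F x"
  by (simp add: semigroup_def mean_def)

lemma continuous_on_semigroup:
  assumes "continuous_on UNIV F" and "bounded (range F)"
  shows "continuous_on UNIV (\<lambda>(h, x). semigroup h F x)"
proof -
  have "continuous_on UNIV (\<lambda>p. (\<lambda>(m, \<sigma>). normal_expectation F m \<sigma>)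
      (mean (fst p) (snd p), c * sqrt (expm1_quot (2 * b) (fst p))))"
    by (rule continuous_on_compose2[OF continuous_on_normal_expectation[OF assms]])
       (auto simp: mean_def intro!: continuous_intros)
  thus ?thesis by (simp add: semigroup_def case_prod_unfold)
qed

lemma continuous_on_semigroup_at:
  assumes "continuous_on UNIV F" and "bounded (range F)"
  shows "continuous_on UNIV (semigroup h F)"
  using continuous_on_compose2[OF continuous_on_semigroup[OF assms], of UNIV "\<lambda>x. (h, x)"]
  by (simp add: continuous_on_Pair)

lemma bounded_semigroup:
  assumes "continuous_on UNIV F" and "bounded (range F)"
  shows "bounded (range (semigroup h F))"
  unfolding semigroup_def[abs_def]
  by (intro bounded_normal_expectation borel_measurable_continuous_onI assms)

context
  fixes F :: "real \<Rightarrow> 'b::{banach, second_countable_topology}"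
  assumes c_nonzero: "c \<noteq> 0" and F_regular: "F \<in> borel_measurable borel" "bounded (range F)"
begin

lemma var_pos: "0 < h \<Longrightarrow> 0 < var h"
  using c_nonzero by (simp add: var_def expm1_quot_pos)

lemma semigroup_eq_deriv_0:
  assumes "0 < h"
  shows "semigroup h F x = semigroup_deriv 0 h F x"
proof -
  have pos: "0 < expm1_quot (2 * b) h" using assms by (rule expm1_quot_pos)
  hence "semigroup h F x = gauss_conv F 0 ((c * sqrt (expm1_quot (2 * b) h))\<^sup>2) (mean h x)"
    unfolding semigroup_def using c_nonzero F_regular(1) by (intro normal_expectation_eq_gauss_conv) auto
  thus ?thesis using pos by (simp add: semigroup_deriv_def var_def power_mult_distrib)
qed

lemma continuous_on_semigroup_deriv: "continuous_on ({0<..} \<times> UNIV) (\<lambda>(h, x). semigroup_deriv k h F x)"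
proof -
  have "continuous_on ({0<..} \<times> UNIV) (\<lambda>p. (\<lambda>(v, m). gauss_conv F k v m) (var (fst p), mean (fst p) (snd p)))"
    by (rule continuous_on_compose2[OF continuous_on_gauss_conv[OF F_regular]])
       (auto simp: var_pos, auto simp: var_def mean_def intro!: continuous_intros)
  thus ?thesis
    by (auto simp: semigroup_deriv_def case_prod_unfold intro!: continuous_intros)
qed

lemma semigroup_deriv_has_vector_derivative:
  assumes h_pos: "0 < h"
  shows "(semigroup_deriv k h F has_vector_derivative semigroup_deriv (Suc k) h F x) (at x)"
proof -
  have "((\<lambda>x. gauss_conv F k (var h) (mean h x)) has_vector_derivative
      (0 / 2) *\<^sub>R gauss_conv F (k + 2) (var h) (mean h x)
      + exp (b * h) *\<^sub>R gauss_conv F (k + 1) (var h) (mean h x)) (at x)"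
    by (rule gauss_conv_has_vector_derivative[OF F_regular open_UNIV])
      (auto simp: mean_def[abs_def] var_pos[OF h_pos] intro!: derivative_eq_intros)
  from has_vector_derivative_scaleR[OF DERIV_const this, of "exp (b * h) ^ k"]
  show ?thesis by (simp add: semigroup_deriv_def[abs_def] mult.commute)
qed

lemma semigroup_deriv_0_has_time_derivative:
  assumes h_pos: "0 < h"
  shows "((\<lambda>h. semigroup_deriv 0 h F x) has_vector_derivative
    (a + b * x) *\<^sub>R semigroup_deriv 1 h F x + (c\<^sup>2 / 2) *\<^sub>R semigroup_deriv 2 h F x) (at h)"
proof -
  have "((\<lambda>h. gauss_conv F 0 (var h) (mean h x)) has_vector_derivative
      (c\<^sup>2 * exp (2 * b * h) / 2) *\<^sub>R gauss_conv F (0 + 2) (var h) (mean h x)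
      + ((a + b * x) * exp (b * h)) *\<^sub>R gauss_conv F (0 + 1) (var h) (mean h x)) (at h)"
    by (rule gauss_conv_has_vector_derivative[OF F_regular, where S = "{0<..}"
          and v' = "\<lambda>h. c\<^sup>2 * exp (2 * b * h)" and m' = "\<lambda>h. (a + b * x) * exp (b * h)"])
      (auto simp: mean_def[abs_def] var_pos h_pos, auto simp: var_def[abs_def] algebra_simps
        intro!: derivative_eq_intros continuous_intros)
  moreover have "exp (2 * b * h) = exp (b * h) ^ 2"
    by (simp add: exp_double[symmetric] mult_ac)
  ultimately show ?thesis
    by (simp add: semigroup_deriv_def add.commute mult_ac numeral_2_eq_2)
qed

end

section \<open>The backward equation\<close>

definition backward_solution_on :: "real \<Rightarrow> real \<Rightarrow> (real \<Rightarrow> real \<Rightarrow> complex) \<Rightarrow> bool" where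
  "backward_solution_on l r f \<longleftrightarrow> continuous_on ({l<..r} \<times> UNIV) (\<lambda>(t, x). f t x)
    \<and> C1_in_t ({l<..<r} \<times> UNIV) f
    \<and> Cinf_in_x ({l<..<r} \<times> UNIV) f
    \<and> (\<forall>t\<in>{l<..<r}. \<forall>x.
           vector_derivative (\<lambda>s. f s x) (at t)
         + complex_of_real (a + b * x) * vector_derivative (\<lambda>y. f t y) (at x)
         + complex_of_real (c\<^sup>2 / 2) *
             vector_derivative (\<lambda>y. vector_derivative (\<lambda>z. f t z) (at y)) (at x) = 0)"

context
  fixes F :: "real \<Rightarrow> complex" and f :: "real \<Rightarrow> real \<Rightarrow> complex" and l r :: real
  assumes F_cont: "continuous_on UNIV F" and F_bounded: "bounded (range F)"
    and f_eq: "\<And>t x. t \<in> {l<..r} \<Longrightarrow> f t x = semigroup (r - t) F x"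
begin

lemma continuous_on_backward_semigroup: "continuous_on UNIV (\<lambda>(t, x). semigroup (r - t) F x)"
proof -
  have "continuous_on UNIV (\<lambda>p. (\<lambda>(h, x). semigroup h F x) (r - fst p, snd p))"
    by (rule continuous_on_compose2[OF continuous_on_semigroup[OF F_cont F_bounded]])
       (auto intro!: continuous_intros)
  thus ?thesis by (simp add: case_prod_unfold)
qed

lemma continuous_on_backward: "continuous_on ({l<..r} \<times> UNIV) (\<lambda>(t, x). f t x)"
  by (rule continuous_on_eq[OF continuous_on_subset[OF continuous_on_backward_semigroup]]) (auto simp: f_eq)

lemma backward_tendsto_at_right:
  assumes "l < r"
  shows "((\<lambda>t. f t x) \<longlongrightarrow> semigroup (r - l) F x) (at_right l)"
proof -
  have "continuous_on UNIV (\<lambda>t. (\<lambda>(t, x). semigroup (r - t) F x) (t, x))"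
    by (rule continuous_on_compose2[OF continuous_on_backward_semigroup]) (auto intro!: continuous_intros)
  hence "((\<lambda>t. semigroup (r - t) F x) \<longlongrightarrow> semigroup (r - l) F x) (at_right l)"
    by (auto simp: continuous_on_eq_continuous_at isCont_def intro: tendsto_mono[OF at_le])
  moreover have "\<forall>\<^sub>F t in at_right l. semigroup (r - t) F x = f t x"
    unfolding eventually_at_right_field using assms f_eq by (intro exI[of _ r]) auto
  ultimately show ?thesis
    by (rule Lim_transform_eventually)
qed

context
  assumes c_nonzero: "c \<noteq> 0"
begin

lemmas F_measurable = borel_measurable_continuous_onI[OF F_cont]

lemma continuous_on_backward_deriv:
  "continuous_on ({l<..<r} \<times> UNIV) (\<lambda>(t, x). semigroup_deriv k (r - t) F x)"
proof -
  have "continuous_on ({l<..<r} \<times> UNIV) (\<lambda>p. (\<lambda>(h, x). semigroup_deriv k h F x) (r - fst p, snd p))"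
    by (rule continuous_on_compose2[OF continuous_on_semigroup_deriv[OF c_nonzero F_measurable F_bounded]])
      (auto intro!: continuous_intros)
  thus ?thesis by (simp add: case_prod_unfold)
qed

lemma backward_eq_deriv_0:
  assumes "t \<in> {l<..<r}"
  shows "f t = semigroup_deriv 0 (r - t) F"
  using assms by (intro ext) (simp add: f_eq semigroup_eq_deriv_0[OF c_nonzero F_measurable F_bounded])

lemma backward_has_time_derivative:
  assumes t_in: "t \<in> {l<..<r}"
  shows "((\<lambda>s. f s x) has_vector_derivative
    - ((a + b * x) *\<^sub>R semigroup_deriv 1 (r - t) F x + (c\<^sup>2 / 2) *\<^sub>R semigroup_deriv 2 (r - t) F x)) (at t)"
proof (rule has_vector_derivative_transform_within_open[where S = "{l<..<r}"])
  have "((\<lambda>s. r - s) has_vector_derivative - 1) (at t)"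
    by (auto intro!: derivative_eq_intros)
  from vector_diff_chain_at[OF this semigroup_deriv_0_has_time_derivative[OF c_nonzero F_measurable F_bounded]] t_in
  show "((\<lambda>s. semigroup_deriv 0 (r - s) F x) has_vector_derivative
      - ((a + b * x) *\<^sub>R semigroup_deriv 1 (r - t) F x + (c\<^sup>2 / 2) *\<^sub>R semigroup_deriv 2 (r - t) F x)) (at t)"
    by (simp add: comp_def)
qed (use t_in backward_eq_deriv_0 in auto)

lemma backward_has_space_derivative:
  assumes t_in: "t \<in> {l<..<r}"
  shows "(semigroup_deriv k (r - t) F has_vector_derivative semigroup_deriv (Suc k) (r - t) F x) (at x)"
  using t_in by (intro semigroup_deriv_has_vector_derivative[OF c_nonzero F_measurable F_bounded]) auto

lemma C1_in_t_backward: "C1_in_t ({l<..<r} \<times> UNIV) f"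
  unfolding C1_in_t_def
proof (intro exI conjI)
  show "\<forall>(t, x)\<in>{l<..<r} \<times> UNIV. ((\<lambda>s. f s x) has_vector_derivative
      - ((a + b * x) *\<^sub>R semigroup_deriv 1 (r - t) F x + (c\<^sup>2 / 2) *\<^sub>R semigroup_deriv 2 (r - t) F x)) (at t)"
    using backward_has_time_derivative by auto
  show "continuous_on ({l<..<r} \<times> UNIV) (\<lambda>(t, x).
      - ((a + b * x) *\<^sub>R semigroup_deriv 1 (r - t) F x + (c\<^sup>2 / 2) *\<^sub>R semigroup_deriv 2 (r - t) F x))"
    using continuous_on_backward_deriv unfolding case_prod_unfold by (intro continuous_intros)
qed

lemma Cinf_in_x_backward: "Cinf_in_x ({l<..<r} \<times> UNIV) f"
  unfolding Cinf_in_x_def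
  by (intro exI[of _ "\<lambda>k t. semigroup_deriv k (r - t) F"])
     (auto simp: backward_eq_deriv_0 backward_has_space_derivative continuous_on_backward_deriv)

lemma backward_equation:
  assumes t_in: "t \<in> {l<..<r}"
  shows "vector_derivative (\<lambda>s. f s x) (at t)
         + complex_of_real (a + b * x) * vector_derivative (\<lambda>y. f t y) (at x)
         + complex_of_real (c\<^sup>2 / 2) *
             vector_derivative (\<lambda>y. vector_derivative (\<lambda>z. f t z) (at y)) (at x) = 0"
proof -
  note space = vector_derivative_at[OF backward_has_space_derivative[OF t_in]]
  have "vector_derivative (\<lambda>y. f t y) (at x) = semigroup_deriv 1 (r - t) F x" for x
    using space[of 0] by (simp add: backward_eq_deriv_0[OF t_in])
  moreover have "vector_derivative (semigroup_deriv 1 (r - t) F) (at x) = semigroup_deriv 2 (r - t) F x"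
    using space[of 1] by (simp add: numeral_2_eq_2)
  ultimately show ?thesis
    by (simp add: vector_derivative_at[OF backward_has_time_derivative[OF t_in]] scaleR_conv_of_real)
qed

lemma backward_solution_on_semigroup: "backward_solution_on l r f"
  unfolding backward_solution_on_def
  using continuous_on_backward C1_in_t_backward Cinf_in_x_backward backward_equation by blast

end

end

end

section \<open>Chains driven by independent noise\<close>

lemma bounded_range_mult:
  fixes f g :: "'a \<Rightarrow> 'b::real_normed_algebra"
  assumes "bounded (range f)" "bounded (range g)"
  shows "bounded (range (\<lambda>x. f x * g x))"
proof -
  obtain A B where bounds: "\<And>x. norm (f x) \<le> A" "\<And>x. norm (g x) \<le> B"
    using assms by (auto simp: bounded_iff)
  have "norm (f x * g x) \<le> A * B" for x
    using order_trans[OF norm_ge_zero bounds(1)] bounds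
    by (intro order_trans[OF norm_mult_ineq] mult_mono) auto
  thus ?thesis by (auto simp: bounded_iff)
qed

lemma prod_bounded_rangeE:
  fixes \<phi> :: "'i \<Rightarrow> 'a \<Rightarrow> 'b::real_normed_field"
  assumes "\<And>i. bounded (range (\<phi> i))"
  obtains C where "\<And>y. norm (\<Prod>i\<in>I. \<phi> i (y i)) \<le> C"
proof -
  obtain B where "\<And>i y. norm (\<phi> i y) \<le> B i"
    using assms by (simp add: bounded_iff) metis
  hence "norm (\<Prod>i\<in>I. \<phi> i (y i)) \<le> (\<Prod>i\<in>I. B i)" for y
    unfolding prod_norm[symmetric] by (intro prod_mono) simp
  thus thesis by (rule that)
qed

lemma (in prob_space) indep_vars_Suc:
  assumes "indep_vars (\<lambda>_. borel) Z {..<Suc m}"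
  shows "indep_vars (\<lambda>_. borel) (\<lambda>k. Z (Suc k)) {..<m}"
proof -
  have "indep_vars (\<lambda>k. PiM {Suc k} (\<lambda>_. borel)) (\<lambda>k \<omega>. \<lambda>i\<in>{Suc k}. Z i \<omega>) {..<m}"
    by (rule indep_vars_restrict[OF assms]) (auto simp: disjoint_family_on_def)
  hence "indep_vars (\<lambda>_. borel) (\<lambda>k \<omega>. (\<lambda>i\<in>{Suc k}. Z i \<omega>) (Suc k)) {..<m}"
    by (rule indep_vars_compose2) auto
  thus ?thesis by simp
qed

lemma (in prob_space) expectation_indep_first:
  fixes \<Psi> :: "real \<Rightarrow> (nat \<Rightarrow> real) \<Rightarrow> 'b::{banach, second_countable_topology}"
  assumes indep: "indep_vars (\<lambda>_. borel) Z {..<Suc m}"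
    and \<Psi>_measurable: "(\<lambda>(x, z). \<Psi> x z) \<in> borel_measurable (borel \<Otimes>\<^sub>M PiM {..<m} (\<lambda>_. borel))"
    and bound: "\<And>x z. norm (\<Psi> x z) \<le> C"
  shows "(\<integral>\<omega>. \<Psi> (Z 0 \<omega>) (\<lambda>k\<in>{..<m}. Z (Suc k) \<omega>) \<partial>M)
    = (\<integral>\<omega>. (\<integral>\<omega>'. \<Psi> (Z 0 \<omega>) (\<lambda>k\<in>{..<m}. Z (Suc k) \<omega>') \<partial>M) \<partial>M)"
proof -
  define shift where "shift = (\<lambda>z :: nat \<Rightarrow> real. \<lambda>k\<in>{..<m}. z (Suc k))"
  have "indep_var (PiM {0} (\<lambda>_. borel)) (\<lambda>\<omega>. \<lambda>k\<in>{0}. Z k \<omega>)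
      (PiM {1..<Suc m} (\<lambda>_. borel)) (\<lambda>\<omega>. \<lambda>k\<in>{1..<Suc m}. Z k \<omega>)"
    by (rule indep_var_restrict[OF indep]) auto
  note split = expectation_indep_var[OF this]
  have shift: "shift \<in> measurable (PiM {1..<Suc m} (\<lambda>_. borel)) (PiM {..<m} (\<lambda>_. borel))"
    unfolding shift_def by (intro measurable_restrict measurable_component_singleton) auto
  have "(\<lambda>p. (fst p 0, shift (snd p))) \<in> measurable
      (PiM {0} (\<lambda>_. borel) \<Otimes>\<^sub>M PiM {1..<Suc m} (\<lambda>_. borel)) (borel \<Otimes>\<^sub>M PiM {..<m} (\<lambda>_. borel))"
    by (intro measurable_Pair measurable_compose[OF measurable_fst measurable_component_singleton]
        measurable_compose[OF measurable_snd shift]) auto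
  from measurable_compose[OF this \<Psi>_measurable]
  have "(\<lambda>p. \<Psi> (fst p 0) (shift (snd p))) \<in> borel_measurable (PiM {0} (\<lambda>_. borel) \<Otimes>\<^sub>M PiM {1..<Suc m} (\<lambda>_. borel))"
    by (simp only: prod.case)
  from split[OF this bound] have "(\<integral>\<omega>. \<Psi> (Z 0 \<omega>) (shift (\<lambda>k\<in>{1..<Suc m}. Z k \<omega>)) \<partial>M)
      = (\<integral>\<omega>. (\<integral>\<omega>'. \<Psi> (Z 0 \<omega>) (shift (\<lambda>k\<in>{1..<Suc m}. Z k \<omega>')) \<partial>M) \<partial>M)"
    by simp
  moreover have "shift (\<lambda>k\<in>{1..<Suc m}. Z k \<omega>) = (\<lambda>k\<in>{..<m}. Z (Suc k) \<omega>)" for \<omega>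
    by (auto simp: shift_def)
  ultimately show ?thesis by simp
qed

context ou
begin

primrec chain :: "(nat \<Rightarrow> real) \<Rightarrow> real \<Rightarrow> (nat \<Rightarrow> real) \<Rightarrow> nat \<Rightarrow> real" where
  "chain \<tau> x z 0 = x"
| "chain \<tau> x z (Suc k) = mean (\<tau> (Suc k) - \<tau> k) (chain \<tau> x z k) + c * z k"

lemma chain_Suc_shift:
  "chain \<tau> x z (Suc k) = chain (\<lambda>i. \<tau> (Suc i)) (mean (\<tau> 1 - \<tau> 0) x + c * z 0) (\<lambda>i. z (Suc i)) k"
  by (induction k) simp_all

lemma chain_cong: "(\<And>i. i < k \<Longrightarrow> z i = z' i) \<Longrightarrow> chain \<tau> x z k = chain \<tau> x z' k"
  by (induction k) simp_all

lemma chain_measurable: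
  assumes "g \<in> borel_measurable N" and "\<And>i. i < k \<Longrightarrow> (\<lambda>p. z p i) \<in> borel_measurable N"
  shows "(\<lambda>p. chain \<tau> (g p) (z p) k) \<in> borel_measurable N"
  using assms by (induction k) (auto simp: mean_def)

primrec backward_value :: "(nat \<Rightarrow> real) \<Rightarrow> (nat \<Rightarrow> real \<Rightarrow> 'b) \<Rightarrow> nat \<Rightarrow> real \<Rightarrow>
    'b::{real_normed_field, banach, second_countable_topology}" where
  "backward_value \<tau> \<phi> 0 = \<phi> 0"
| "backward_value \<tau> \<phi> (Suc m) = (\<lambda>x. \<phi> 0 x *
    semigroup (\<tau> 1 - \<tau> 0) (backward_value (\<lambda>i. \<tau> (Suc i)) (\<lambda>i. \<phi> (Suc i)) m) x)"

lemma continuous_bounded_backward_value: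
  assumes "\<And>i. continuous_on UNIV (\<phi> i)" and "\<And>i. bounded (range (\<phi> i))"
  shows "continuous_on UNIV (backward_value \<tau> \<phi> m) \<and> bounded (range (backward_value \<tau> \<phi> m))"
  using assms
proof (induction m arbitrary: \<tau> \<phi>)
  case (Suc m)
  let ?V = "backward_value (\<lambda>i. \<tau> (Suc i)) (\<lambda>i. \<phi> (Suc i)) m"
  have "continuous_on UNIV ?V" "bounded (range ?V)"
    using Suc.IH[of "\<lambda>i. \<phi> (Suc i)"] Suc.prems by auto
  thus ?case
    unfolding backward_value.simps
    by (intro conjI continuous_on_mult continuous_on_semigroup_at bounded_range_mult bounded_semigroup Suc.prems)
qed simp

lemmas continuous_on_backward_value = continuous_bounded_backward_value[THEN conjunct1]
lemmas bounded_backward_value = continuous_bounded_backward_value[THEN conjunct2]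

lemma expectation_chain_Suc:
  fixes \<phi> :: "nat \<Rightarrow> real \<Rightarrow> 'b::{real_normed_field, banach, second_countable_topology}"
  assumes prob: "prob_space M" and indep: "prob_space.indep_vars M (\<lambda>_. borel) Z {..<Suc m}"
    and \<phi>_regular: "\<And>i. continuous_on UNIV (\<phi> i)" "\<And>i. bounded (range (\<phi> i))"
  shows "(\<integral>\<omega>. (\<Prod>i\<le>Suc m. \<phi> i (chain \<tau> x (\<lambda>k. Z k \<omega>) i)) \<partial>M)
    = \<phi> 0 x * (\<integral>\<omega>. (\<integral>\<omega>'. (\<Prod>i\<le>m. \<phi> (Suc i) (chain (\<lambda>i. \<tau> (Suc i))
        (mean (\<tau> 1 - \<tau> 0) x + c * Z 0 \<omega>) (\<lambda>k. Z (Suc k) \<omega>') i)) \<partial>M) \<partial>M)"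
proof -
  interpret prob_space M by (rule prob)
  define \<Psi> where "\<Psi> = (\<lambda>z0 z. \<Prod>i\<le>m. \<phi> (Suc i) (chain (\<lambda>i. \<tau> (Suc i)) (mean (\<tau> 1 - \<tau> 0) x + c * z0) z i))"
  have [measurable]: "\<phi> i \<in> borel_measurable borel" for i
    by (rule borel_measurable_continuous_onI[OF \<phi>_regular(1)])
  obtain C where prod_bound: "\<And>y. norm (\<Prod>i\<in>{..m}. \<phi> (Suc i) (y i)) \<le> C"
    using prod_bounded_rangeE[of "\<lambda>i. \<phi> (Suc i)" "{..m}"] \<phi>_regular(2) by blast
  have \<Psi>_measurable: "(\<lambda>(z0, z). \<Psi> z0 z) \<in> borel_measurable (borel \<Otimes>\<^sub>M PiM {..<m} (\<lambda>_. borel))"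
    unfolding \<Psi>_def case_prod_unfold
    by (intro borel_measurable_prod measurable_compose[OF _ \<open>\<phi> _ \<in> _\<close>] chain_measurable) auto
  have restrict: "\<Psi> z0 (\<lambda>k\<in>{..<m}. Z (Suc k) \<omega>) = \<Psi> z0 (\<lambda>k. Z (Suc k) \<omega>)" for z0 \<omega>
    unfolding \<Psi>_def by (intro prod.cong refl arg_cong[of _ _ "\<phi> _"] chain_cong) auto
  have "(\<Prod>i\<le>Suc m. \<phi> i (chain \<tau> x (\<lambda>k. Z k \<omega>) i)) = \<phi> 0 x * \<Psi> (Z 0 \<omega>) (\<lambda>k. Z (Suc k) \<omega>)" for \<omega>
    unfolding \<Psi>_def prod.atMost_Suc_shift chain_Suc_shift by simp
  hence "(\<integral>\<omega>. (\<Prod>i\<le>Suc m. \<phi> i (chain \<tau> x (\<lambda>k. Z k \<omega>) i)) \<partial>M)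
      = \<phi> 0 x * (\<integral>\<omega>. \<Psi> (Z 0 \<omega>) (\<lambda>k. Z (Suc k) \<omega>) \<partial>M)"
    by simp
  also have "(\<integral>\<omega>. \<Psi> (Z 0 \<omega>) (\<lambda>k. Z (Suc k) \<omega>) \<partial>M)
      = (\<integral>\<omega>. (\<integral>\<omega>'. \<Psi> (Z 0 \<omega>) (\<lambda>k. Z (Suc k) \<omega>') \<partial>M) \<partial>M)"
    using expectation_indep_first[OF indep \<Psi>_measurable, of C] prod_bound unfolding restrict by (simp add: \<Psi>_def)
  finally show ?thesis by (simp only: \<Psi>_def)
qed

lemma expectation_chain:
  fixes \<phi> :: "nat \<Rightarrow> real \<Rightarrow> 'b::{real_normed_field, banach, second_countable_topology}"
  assumes prob: "prob_space M" and "prob_space.indep_vars M (\<lambda>_. borel) Z {..<m}"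
    and "\<And>k F :: real \<Rightarrow> 'b. k < m \<Longrightarrow> continuous_on UNIV F \<Longrightarrow> bounded (range F) \<Longrightarrow>
      (\<integral>\<omega>. F (Z k \<omega>) \<partial>M) = normal_expectation F 0 (sqrt (expm1_quot (2 * b) (\<tau> (Suc k) - \<tau> k)))"
    and "\<And>i. continuous_on UNIV (\<phi> i)" "\<And>i. bounded (range (\<phi> i))"
  shows "(\<integral>\<omega>. (\<Prod>i\<le>m. \<phi> i (chain \<tau> x (\<lambda>k. Z k \<omega>) i)) \<partial>M) = backward_value \<tau> \<phi> m x"
  using assms(2-)
proof (induction m arbitrary: \<tau> \<phi> Z x)
  case 0
  interpret prob_space M by (rule prob)
  show ?case by (simp add: prob_space)
next
  case (Suc m)
  interpret prob_space M by (rule prob)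
  let ?\<tau> = "\<lambda>i. \<tau> (Suc i)" and ?\<phi> = "\<lambda>i. \<phi> (Suc i)" and ?start = "\<lambda>z. mean (\<tau> 1 - \<tau> 0) x + c * z"
  let ?V = "backward_value ?\<tau> ?\<phi> m"
  have "(\<integral>\<omega>. (\<Prod>i\<le>m. ?\<phi> i (chain ?\<tau> y (\<lambda>k. Z (Suc k) \<omega>) i)) \<partial>M) = ?V y" for y
    by (intro Suc.IH indep_vars_Suc Suc.prems) auto
  hence "(\<integral>\<omega>. (\<Prod>i\<le>Suc m. \<phi> i (chain \<tau> x (\<lambda>k. Z k \<omega>) i)) \<partial>M) = \<phi> 0 x * (\<integral>\<omega>. ?V (?start (Z 0 \<omega>)) \<partial>M)"
    unfolding expectation_chain_Suc[where \<phi> = \<phi>, OF prob Suc.prems(1,3,4)] by simp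
  also have "(\<integral>\<omega>. ?V (?start (Z 0 \<omega>)) \<partial>M) = semigroup (\<tau> 1 - \<tau> 0) ?V x"
  proof -
    have "continuous_on UNIV ?V" "bounded (range ?V)"
      by (rule continuous_on_backward_value bounded_backward_value; fact Suc.prems)+
    hence "continuous_on UNIV (\<lambda>z. ?V (?start z))" "bounded (range (\<lambda>z. ?V (?start z)))"
      by (auto intro!: continuous_on_compose2[of UNIV ?V] continuous_intros elim: bounded_subset)
    from Suc.prems(2)[OF _ this, of 0] show ?thesis
      by (simp add: semigroup_def normal_expectation_shift)
  qed
  finally show ?case by simp
qed

end

section \<open>Solutions of the stochastic equation\<close>

locale ou_process = ou a b c + brownian M W
  for a b c :: real and M :: "'a measure" and W :: "real \<Rightarrow> 'a \<Rightarrow> real" +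
  fixes X :: "real \<Rightarrow> real \<Rightarrow> real \<Rightarrow> 'a \<Rightarrow> real" and T :: real
  assumes X_measurable: "\<And>t x s. t \<in> {0..T} \<Longrightarrow> s \<in> {t..T} \<Longrightarrow> X t x s \<in> borel_measurable M"
    and X_solution: "\<And>t x. t \<in> {0..T} \<Longrightarrow>
        AE \<omega> in M. continuous_on {t..T} (\<lambda>s. X t x s \<omega>)
          \<and> (\<forall>s\<in>{t..T}. X t x s \<omega> =
               x + integral {t..s} (\<lambda>r. a + b * X t x r \<omega>) + c * (W s \<omega> - W t \<omega>))"
begin

lemma AE_solves_linear:
  assumes t_in: "t \<in> {0..T}"
  shows "AE \<omega> in M. X t x t \<omega> = x \<and> solves_linear a b c (\<lambda>s. W s \<omega>) t T (\<lambda>s. X t x s \<omega>)"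
  using X_solution[OF t_in, of x]
proof eventually_elim
  case (elim \<omega>)
  hence "X t x t \<omega> = x + integral {t..t} (\<lambda>r. a + b * X t x r \<omega>) + c * (W t \<omega> - W t \<omega>)"
    using t_in by auto
  hence "X t x t \<omega> = x" by simp
  with elim show ?case unfolding solves_linear_def by simp
qed

definition noise :: "real \<Rightarrow> real \<Rightarrow> 'a \<Rightarrow> real" where
  "noise r s = wiener_integral (\<lambda>u. exp (b * (s - u))) r s"

lemma expectation_noise:
  assumes interval: "0 \<le> r" "r \<le> s" and F_regular: "continuous_on UNIV F" "bounded (range F)"
  shows "(\<integral>\<omega>. F (noise r s \<omega>) \<partial>M) = normal_expectation F 0 (sqrt (expm1_quot (2 * b) (s - r)))"
proof -
  have "(\<lambda>u. (exp (b * (s - u)))\<^sup>2) = (\<lambda>u. exp (2 * b * (s - u)))"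
    by (simp add: exp_double[symmetric] mult.assoc)
  hence "integral {r..s} (\<lambda>u. (exp (b * (s - u)))\<^sup>2) = expm1_quot (2 * b) (s - r)"
    using integral_unique[OF has_integral_exp_decay[OF interval(2), of "2 * b"]] by simp
  thus ?thesis
    unfolding noise_def using expectation_wiener_integral[OF interval C1_differentiable_on_exp_decay _ F_regular, of b s]
    by simp
qed

context
  fixes \<tau> :: "nat \<Rightarrow> real" and m :: nat
  assumes times: "0 \<le> \<tau> 0" "\<And>k. k < m \<Longrightarrow> \<tau> k \<le> \<tau> (Suc k)" "\<tau> m \<le> T"
begin

lemma time_mono: "k \<le> l \<Longrightarrow> l \<le> m \<Longrightarrow> \<tau> k \<le> \<tau> l"
  by (induction l rule: dec_induct) (use times(2) in \<open>auto intro: order_trans\<close>)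

lemma time_in: "k \<le> m \<Longrightarrow> \<tau> k \<in> {\<tau> 0..T}"
  using time_mono[of 0 k] time_mono[of k m] times by auto

lemma AE_eq_chain:
  "AE \<omega> in M. \<forall>k\<le>m. X (\<tau> 0) x (\<tau> k) \<omega> = chain \<tau> x (\<lambda>k. noise (\<tau> k) (\<tau> (Suc k)) \<omega>) k"
proof -
  have "\<tau> 0 \<in> {0..T}" using time_in[of 0] times(1) by auto
  from AE_solves_linear[OF this, of x] AE_continuous_path show ?thesis
  proof eventually_elim
    case (elim \<omega>)
    hence start: "X (\<tau> 0) x (\<tau> 0) \<omega> = x"
      and solution: "solves_linear a b c (\<lambda>s. W s \<omega>) (\<tau> 0) T (\<lambda>s. X (\<tau> 0) x s \<omega>)"
      and path: "continuous_on {0..} (\<lambda>s. W s \<omega>)"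
      by auto
    have "X (\<tau> 0) x (\<tau> k) \<omega> = chain \<tau> x (\<lambda>k. noise (\<tau> k) (\<tau> (Suc k)) \<omega>) k" if "k \<le> m" for k
      using that
    proof (induction k)
      case (Suc k)
      hence order: "\<tau> 0 \<le> \<tau> k" "\<tau> k \<le> \<tau> (Suc k)" "\<tau> (Suc k) \<le> T"
        using time_in[of k] time_in[of "Suc k"] times(2)[of k] by auto
      have "continuous_on {\<tau> k..\<tau> (Suc k)} (\<lambda>s. W s \<omega>)"
        by (rule continuous_on_subset[OF path]) (use order times(1) in auto)
      from variation_of_constants[OF order(2) this solves_linear_subinterval[OF solution order]] Suc show ?case
        by (simp add: mean_def noise_def wiener_integral_def)
    qed (simp add: start)
    thus ?case by blast
  qed
qed

lemma expectation_prod_samples: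
  fixes \<phi> :: "nat \<Rightarrow> real \<Rightarrow> 'b::{real_normed_field, banach, second_countable_topology}"
  assumes \<phi>_regular: "\<And>i. continuous_on UNIV (\<phi> i)" "\<And>i. bounded (range (\<phi> i))"
  shows "(\<integral>\<omega>. (\<Prod>i\<le>m. \<phi> i (X (\<tau> 0) x (\<tau> i) \<omega>)) \<partial>M) = backward_value \<tau> \<phi> m x"
proof -
  have [measurable]: "\<phi> i \<in> borel_measurable borel" for i
    by (rule borel_measurable_continuous_onI[OF \<phi>_regular(1)])
  have noise [measurable]: "noise (\<tau> k) (\<tau> (Suc k)) \<in> borel_measurable M" if "k < m" for k
    unfolding noise_def using that times time_in[of k] by (intro wiener_integral_measurable) auto
  have "(\<integral>\<omega>. (\<Prod>i\<le>m. \<phi> i (X (\<tau> 0) x (\<tau> i) \<omega>)) \<partial>M)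
      = (\<integral>\<omega>. (\<Prod>i\<le>m. \<phi> i (chain \<tau> x (\<lambda>k. noise (\<tau> k) (\<tau> (Suc k)) \<omega>) i)) \<partial>M)"
  proof (rule integral_cong_AE)
    show "(\<lambda>\<omega>. \<Prod>i\<le>m. \<phi> i (X (\<tau> 0) x (\<tau> i) \<omega>)) \<in> borel_measurable M"
      using time_in times(1)
      by (intro borel_measurable_prod measurable_compose[OF _ \<open>\<phi> _ \<in> _\<close>] X_measurable) fastforce+
    show "(\<lambda>\<omega>. \<Prod>i\<le>m. \<phi> i (chain \<tau> x (\<lambda>k. noise (\<tau> k) (\<tau> (Suc k)) \<omega>) i)) \<in> borel_measurable M"
      by (intro borel_measurable_prod measurable_compose[OF _ \<open>\<phi> _ \<in> _\<close>] chain_measurable noise) auto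
    from AE_eq_chain[of x] show "AE \<omega> in M. (\<Prod>i\<le>m. \<phi> i (X (\<tau> 0) x (\<tau> i) \<omega>))
        = (\<Prod>i\<le>m. \<phi> i (chain \<tau> x (\<lambda>k. noise (\<tau> k) (\<tau> (Suc k)) \<omega>) i))"
      by eventually_elim (auto intro!: prod.cong)
  qed
  also have "\<dots> = backward_value \<tau> \<phi> m x"
  proof (rule expectation_chain[OF prob_space_axioms _ _ \<phi>_regular])
    show "indep_vars (\<lambda>_. borel) (\<lambda>k. noise (\<tau> k) (\<tau> (Suc k))) {..<m}"
      unfolding noise_def by (intro indep_vars_wiener_integrals times C1_differentiable_on_exp_decay)
    fix k and F :: "real \<Rightarrow> 'b" assume k_less: "k < m" and F_regular: "continuous_on UNIV F" "bounded (range F)"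
    show "(\<integral>\<omega>. F (noise (\<tau> k) (\<tau> (Suc k)) \<omega>) \<partial>M)
        = normal_expectation F 0 (sqrt (expm1_quot (2 * b) (\<tau> (Suc k) - \<tau> k)))"
      using times time_in[of k] k_less by (intro expectation_noise F_regular) auto
  qed
  finally show ?thesis .
qed

end

end

section \<open>Functionals sampled along a partition\<close>

locale sampled_ou_process = ou_process a b c M W X T
  for a b c :: real and M :: "'a measure" and W :: "real \<Rightarrow> 'a \<Rightarrow> real"
    and X :: "real \<Rightarrow> real \<Rightarrow> real \<Rightarrow> 'a \<Rightarrow> real" and T :: real +
  fixes \<tau> :: "nat \<Rightarrow> real" and n :: nat
    and \<phi> :: "nat \<Rightarrow> real \<Rightarrow> 'b::{real_normed_field, banach, second_countable_topology}"
  assumes \<tau>_mono: "strict_mono \<tau>" and \<tau>_0: "0 \<le> \<tau> 0" and \<tau>_n: "\<tau> n = T"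
    and \<phi>_cont: "\<And>i. continuous_on UNIV (\<phi> i)" and \<phi>_bounded: "\<And>i. bounded (range (\<phi> i))"
begin

definition sampled_expectation :: "real \<Rightarrow> real \<Rightarrow> 'b" where
  "sampled_expectation t x = (\<integral>\<omega>. (\<Prod>i | i \<le> n \<and> t \<le> \<tau> i. \<phi> i (X t x (\<tau> i) \<omega>)) \<partial>M)"

definition tail_value :: "nat \<Rightarrow> real \<Rightarrow> 'b" where
  "tail_value k = backward_value (\<lambda>i. \<tau> (k + i)) (\<lambda>i. \<phi> (k + i)) (n - k)"

lemma tail_value_last: "tail_value n = \<phi> n"
  by (simp add: tail_value_def)

lemma tail_value_step:
  assumes "k < n"
  shows "tail_value k x = \<phi> k x * semigroup (\<tau> (Suc k) - \<tau> k) (tail_value (Suc k)) x"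
proof -
  have "n - k = Suc (n - Suc k)" using assms by simp
  thus ?thesis by (simp add: tail_value_def)
qed

lemma continuous_on_tail_value: "continuous_on UNIV (tail_value k)"
  unfolding tail_value_def by (intro continuous_on_backward_value \<phi>_cont \<phi>_bounded)

lemma bounded_tail_value: "bounded (range (tail_value k))"
  unfolding tail_value_def by (intro bounded_backward_value \<phi>_cont \<phi>_bounded)

lemma sampled_expectation_eq_semigroup:
  assumes k_le: "k \<le> n" and t_range: "0 \<le> t" "t \<le> \<tau> k" and after: "\<And>i. i < k \<Longrightarrow> \<tau> i < t"
  shows "sampled_expectation t x = semigroup (\<tau> k - t) (tail_value k) x"
proof -
  let ?\<tau> = "case_nat t (\<lambda>i. \<tau> (k + i))" and ?\<phi> = "case_nat (\<lambda>_. 1) (\<lambda>i. \<phi> (k + i))"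
  have le_iff: "t \<le> \<tau> i \<longleftrightarrow> k \<le> i" for i
  proof (cases "k \<le> i")
    case True
    with order_trans[OF t_range(2) strict_mono_leD[OF \<tau>_mono True]] show ?thesis by simp
  next
    case False
    with after[of i] show ?thesis by simp
  qed
  have "{i. i \<le> n \<and> t \<le> \<tau> i} = {k..n}"
    unfolding le_iff by auto
  moreover have "(\<Prod>i\<in>{k..n}. h i) = (\<Prod>i\<le>n - k. h (k + i))" for h :: "nat \<Rightarrow> 'b"
    using prod.shift_bounds_cl_nat_ivl[of h 0 k "n - k"] k_le by (simp add: atLeast0AtMost add.commute)
  ultimately have "(\<Prod>i | i \<le> n \<and> t \<le> \<tau> i. \<phi> i (X t x (\<tau> i) \<omega>))
      = (\<Prod>i\<le>Suc (n - k). ?\<phi> i (X (?\<tau> 0) x (?\<tau> i) \<omega>))" for \<omega>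
    unfolding prod.atMost_Suc_shift by simp
  hence "sampled_expectation t x = (\<integral>\<omega>. (\<Prod>i\<le>Suc (n - k). ?\<phi> i (X (?\<tau> 0) x (?\<tau> i) \<omega>)) \<partial>M)"
    unfolding sampled_expectation_def by simp
  also have "\<dots> = backward_value ?\<tau> ?\<phi> (Suc (n - k)) x"
  proof (rule expectation_prod_samples)
    show "?\<tau> i \<le> ?\<tau> (Suc i)" for i
      using t_range(2) strict_mono_less_eq[OF \<tau>_mono] by (cases i) auto
    show "continuous_on UNIV (?\<phi> i)" "bounded (range (?\<phi> i))" for i
      using \<phi>_cont \<phi>_bounded by (auto split: nat.split)
  qed (use t_range k_le \<tau>_n in auto)
  also have "\<dots> = semigroup (\<tau> k - t) (tail_value k) x"
    by (simp add: tail_value_def)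
  finally show ?thesis .
qed

lemma \<tau>_in: "k \<le> n \<Longrightarrow> \<tau> k \<in> {0..T}"
  using strict_mono_leD[OF \<tau>_mono, of 0 k] strict_mono_leD[OF \<tau>_mono, of k n] \<tau>_0 \<tau>_n by auto

lemma sampled_expectation_between:
  assumes j_less: "j < n" and t_in: "t \<in> {\<tau> j<..\<tau> (Suc j)}"
  shows "sampled_expectation t x = semigroup (\<tau> (Suc j) - t) (tail_value (Suc j)) x"
proof (rule sampled_expectation_eq_semigroup)
  show "\<tau> i < t" if "i < Suc j" for i
    using strict_mono_leD[OF \<tau>_mono, of i j] that t_in by auto
qed (use j_less t_in \<tau>_in[of j] in auto)

lemma sampled_expectation_at: "k \<le> n \<Longrightarrow> sampled_expectation (\<tau> k) x = tail_value k x"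
  using \<tau>_in[of k] by (subst sampled_expectation_eq_semigroup[of k]) (auto simp: strict_monoD[OF \<tau>_mono])

end

section \<open>Power series negligible to double factorial\<close>

lemma double_factorial_pos: "0 < double_factorial k"
  by (induction k rule: double_factorial.induct) auto

lemma dfact_pred_ge_1: "1 \<le> dfact_pred k"
  using double_factorial_pos[of "k - 1"] by (auto simp: dfact_pred_def Suc_le_eq)

lemma conv_radius_negligible_df:
  assumes "negligible_df c"
  shows "conv_radius c = \<infinity>"
proof -
  have "root k \<bar>c k\<bar> \<le> root k (\<bar>c k\<bar> * dfact_pred k)" for k
    using mult_left_mono[OF dfact_pred_ge_1 abs_ge_zero, of "c k" k] by (cases "k = 0") auto
  hence "limsup (\<lambda>k. ereal (root k (norm (c k)))) \<le> limsup (\<lambda>k. ereal (root k (\<bar>c k\<bar> * dfact_pred k)))"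
    by (intro Limsup_mono) auto
  also have "\<dots> = 0" using assms by (simp add: negligible_df_def)
  finally have "limsup (\<lambda>k. ereal (root k (norm (c k)))) \<le> 0" .
  moreover have "limsup (\<lambda>k. ereal (root k (norm (c k)))) \<ge> 0"
    by (rule le_Limsup) (auto intro!: always_eventually real_root_ge_zero)
  ultimately have "limsup (\<lambda>k. ereal (root k (norm (c k)))) = 0" by (rule antisym)
  thus ?thesis by (simp add: conv_radius_def)
qed

lemma summable_norm_negligible_df:
  assumes "negligible_df c"
  shows "summable (\<lambda>k. norm (c k * x ^ k))"
  by (rule abs_summable_in_conv_radius) (simp add: conv_radius_negligible_df[OF assms])

lemma continuous_on_pseries:
  assumes "negligible_df c"
  shows "continuous_on S (pseries c)"
proof (rule continuous_at_imp_continuous_on, rule ballI)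
  show "isCont (pseries c) x" for x
    unfolding pseries_def[abs_def] by (rule isCont_powser_converges_everywhere)
      (rule summable_norm_cancel[OF summable_norm_negligible_df[OF assms]])
qed

lemma pseries_pseries_sq:
  assumes "negligible_df c"
  shows "pseries (pseries_sq c) x = (pseries c x)\<^sup>2"
proof -
  have "pseries c x * pseries c x = (\<Sum>k. \<Sum>i\<le>k. (c i * x ^ i) * (c (k - i) * x ^ (k - i)))"
    unfolding pseries_def using summable_norm_negligible_df[OF assms] by (intro Cauchy_product) auto
  also have "\<dots> = pseries (pseries_sq c) x"
    unfolding pseries_def pseries_sq_def
  proof (intro suminf_cong)
    fix k
    show "(\<Sum>i\<le>k. (c i * x ^ i) * (c (k - i) * x ^ (k - i))) = (\<Sum>i\<le>k. c i * c (k - i)) * x ^ k"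
      unfolding sum_distrib_right
      by (intro sum.cong refl) (simp add: power_add[symmetric] mult.assoc mult.left_commute)
  qed
  finally show ?thesis by (simp add: power2_eq_square)
qed

lemma continuous_on_of_real_pseries:
  assumes "negligible_df c"
  shows "continuous_on S (\<lambda>x. complex_of_real (pseries c x))"
    and "continuous_on S (\<lambda>x. complex_of_real (pseries (pseries_sq c) x))"
  unfolding pseries_pseries_sq[OF assms]
  by (intro continuous_intros continuous_on_pseries[OF assms])+

definition running_exponent ::
    "real \<Rightarrow> (real \<Rightarrow> complex) \<Rightarrow> (real \<Rightarrow> complex) \<Rightarrow> (real \<Rightarrow> complex) \<Rightarrow>
     (nat \<Rightarrow> real) \<Rightarrow> (nat \<Rightarrow> real) \<Rightarrow> (nat \<Rightarrow> real) \<Rightarrow> real \<Rightarrow> real \<Rightarrow> complex" where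
  "running_exponent h u1 u2 u3 p p2 p3 t x = complex_of_real h *
     (u1 t * complex_of_real (pseries (pseries_sq p) x)
    + u2 t * complex_of_real (pseries p2 x)
    + u3 t * complex_of_real (pseries p3 x))"

definition sample_weight ::
    "nat \<Rightarrow> (nat \<Rightarrow> real \<Rightarrow> complex) \<Rightarrow> (real \<Rightarrow> complex) \<Rightarrow> nat \<Rightarrow> real \<Rightarrow> complex" where
  "sample_weight n e g i x = (if i < n then exp (e i x) else exp (g x))"

lemma continuous_on_running_exponent:
  assumes "negligible_df p" "negligible_df p2" "negligible_df p3"
  shows "continuous_on S (running_exponent h u1 u2 u3 p p2 p3 t)"
  unfolding running_exponent_def by (intro continuous_intros continuous_on_of_real_pseries assms)

lemma Re_running_exponent_nonpos:
  assumes "0 \<le> h" "negligible_df p" "Re (u1 t) \<le> 0" "Re (u2 t) = 0" "Re (u3 t) = 0"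
  shows "Re (running_exponent h u1 u2 u3 p p2 p3 t x) \<le> 0"
  using assms by (simp add: running_exponent_def pseries_pseries_sq mult_nonneg_nonpos mult_nonpos_nonneg)

lemma prod_sample_weight:
  assumes "P n"
  shows "(\<Prod>i | i \<le> n \<and> P i. sample_weight n e g i (y i)) = exp ((\<Sum>i | i < n \<and> P i. e i (y i)) + g (y n))"
proof -
  have "{i. i \<le> n \<and> P i} = insert n {i. i < n \<and> P i}"
    using assms by auto
  thus ?thesis
    by (simp add: sample_weight_def exp_add exp_sum mult.commute)
qed

lemma continuous_on_sample_weight:
  assumes "\<And>i. continuous_on S (e i)" and "continuous_on S g"
  shows "continuous_on S (sample_weight n e g i)"
  using assms unfolding sample_weight_def[abs_def] by (cases "i < n") (auto intro!: continuous_intros)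

lemma bounded_sample_weight:
  assumes "\<And>i x. i < n \<Longrightarrow> Re (e i x) \<le> 0" and "\<And>x. Re (g x) \<le> 0"
  shows "bounded (range (sample_weight n e g i))"
  using assms by (auto simp: bounded_iff sample_weight_def intro!: exI[of _ 1])

lemma (in ou_process) exponential_sampled_functional:
  fixes e :: "nat \<Rightarrow> real \<Rightarrow> complex" and g :: "real \<Rightarrow> complex"
  assumes "c \<noteq> 0" and partition: "strict_mono \<tau>" "0 \<le> \<tau> 0" "\<tau> n = T" and "j < n"
    and e_regular: "\<And>i. continuous_on UNIV (e i)" "\<And>i x. i < n \<Longrightarrow> Re (e i x) \<le> 0"
    and g_regular: "continuous_on UNIV g" "\<And>x. Re (g x) \<le> 0"
    and f_eq: "\<And>t x. t \<le> T \<Longrightarrow>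
      f t x = (\<integral>\<omega>. exp ((\<Sum>i | i < n \<and> t \<le> \<tau> i. e i (X t x (\<tau> i) \<omega>)) + g (X t x T \<omega>)) \<partial>M)"
  shows "backward_solution_on (\<tau> j) (\<tau> (Suc j)) f"
    and "((\<lambda>s. f s x) \<longlongrightarrow> f (\<tau> j) x * exp (- e j x)) (at_right (\<tau> j))"
    and "f T x = exp (g x)"
proof -
  interpret sampled_ou_process a b c M W X T \<tau> n "sample_weight n e g"
    using partition e_regular g_regular
      by unfold_locales (auto intro!: continuous_on_sample_weight bounded_sample_weight)
  have f_sampled: "f t x = sampled_expectation t x" if "t \<le> T" for t x
    using that partition(3) unfolding sampled_expectation_def by (subst prod_sample_weight) (auto simp: f_eq)
  have "f t x = semigroup (\<tau> (Suc j) - t) (tail_value (Suc j)) x" if "t \<in> {\<tau> j<..\<tau> (Suc j)}" for t x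
    using that \<tau>_in[of "Suc j"] \<open>j < n\<close> sampled_expectation_between by (simp add: f_sampled)
  note backward = continuous_on_tail_value bounded_tail_value this
  show "backward_solution_on (\<tau> j) (\<tau> (Suc j)) f"
    by (rule backward_solution_on_semigroup[OF backward \<open>c \<noteq> 0\<close>])
  have "f (\<tau> j) x * exp (- e j x) = semigroup (\<tau> (Suc j) - \<tau> j) (tail_value (Suc j)) x"
    using \<tau>_in[of j] \<open>j < n\<close> sampled_expectation_at[of j] tail_value_step[of j]
    by (simp add: f_sampled sample_weight_def exp_minus)
  with backward_tendsto_at_right[OF backward strict_monoD[OF partition(1) lessI]]
  show "((\<lambda>s. f s x) \<longlongrightarrow> f (\<tau> j) x * exp (- e j x)) (at_right (\<tau> j))"
    by simp
  show "f T x = exp (g x)"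
    using sampled_expectation_at[of n] partition(3) by (simp add: f_sampled tail_value_last sample_weight_def)
qed

theorem theorem7p7:
  fixes M :: "'a measure" and W :: "real \<Rightarrow> 'a \<Rightarrow> real"
    and a b c T :: real
    and X :: "real \<Rightarrow> real \<Rightarrow> real \<Rightarrow> 'a \<Rightarrow> real"
    and u1 u2 u3 v :: "real \<Rightarrow> complex"
    and p p2 p3 q :: "nat \<Rightarrow> real"
    and n j :: nat
    and f :: "real \<Rightarrow> real \<Rightarrow> complex"
  assumes BM: "brownian_motion M W"
    and c_ne: "c \<noteq> 0" and T_pos: "T > 0"
    and X_meas: "\<And>t x s. t \<in> {0..T} \<Longrightarrow> s \<in> {t..T} \<Longrightarrow> X t x s \<in> borel_measurable M"
    and X_sol: "\<And>t x. t \<in> {0..T} \<Longrightarrow>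
        AE \<omega> in M. continuous_on {t..T} (\<lambda>s. X t x s \<omega>)
          \<and> (\<forall>s\<in>{t..T}. X t x s \<omega> =
               x + integral {t..s} (\<lambda>r. a + b * X t x r \<omega>) + c * (W s \<omega> - W t \<omega>))"
    and u_cont: "continuous_on {0..T} u1" "continuous_on {0..T} u2"
                "continuous_on {0..T} u3" "continuous_on {0..T} v"
    and u_re: "\<And>t. t \<in> {0..T} \<Longrightarrow> Re (u1 t) \<le> 0"
              "\<And>t. t \<in> {0..T} \<Longrightarrow> Re (u2 t) = 0"
              "\<And>t. t \<in> {0..T} \<Longrightarrow> Re (u3 t) = 0"
              "\<And>t. t \<in> {0..T} \<Longrightarrow> Re (v t) = 0"
    and p_negl: "negligible_df p" "negligible_df p2" "negligible_df p3" "negligible_df q"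
    and n_pos: "n \<ge> 1" and j_lt: "j < n"
    and f_def: "f = (\<lambda>t x. integral\<^sup>L M (\<lambda>\<omega>.
        exp ((\<Sum>i\<in>{i. i < n \<and> t \<le> real i * T / real n}.
                 complex_of_real (T / real n) *
                   (u1 (real i * T / real n) * complex_of_real (pseries (pseries_sq p) (X t x (real i * T / real n) \<omega>))
                  + u2 (real i * T / real n) * complex_of_real (pseries p2 (X t x (real i * T / real n) \<omega>))
                  + u3 (real i * T / real n) * complex_of_real (pseries p3 (X t x (real i * T / real n) \<omega>))))
             + v T * complex_of_real (pseries q (X t x T \<omega>)))))"
  shows "continuous_on ({real j * T / real n <.. real (Suc j) * T / real n} \<times> UNIV) (\<lambda>(t, x). f t x)
    \<and> C1_in_t ({real j * T / real n <..< real (Suc j) * T / real n} \<times> UNIV) f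
    \<and> Cinf_in_x ({real j * T / real n <..< real (Suc j) * T / real n} \<times> UNIV) f
    \<and> (\<forall>t\<in>{real j * T / real n <..< real (Suc j) * T / real n}. \<forall>x.
           vector_derivative (\<lambda>s. f s x) (at t)
         + complex_of_real (a + b * x) * vector_derivative (\<lambda>y. f t y) (at x)
         + complex_of_real (c\<^sup>2 / 2) *
             vector_derivative (\<lambda>y. vector_derivative (\<lambda>z. f t z) (at y)) (at x) = 0)
    \<and> (\<forall>x. ((\<lambda>s. f s x) \<longlongrightarrow>
           f (real j * T / real n) x *
             exp (- complex_of_real (T / real n) *
               (u1 (real j * T / real n) * complex_of_real (pseries (pseries_sq p) x)
              + u2 (real j * T / real n) * complex_of_real (pseries p2 x)
              + u3 (real j * T / real n) * complex_of_real (pseries p3 x))))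
           (at_right (real j * T / real n)))
    \<and> (\<forall>x. f T x = exp (v T * complex_of_real (pseries q x)))"
proof -
  have "prob_space M" using BM by (simp add: brownian_motion_def)
  then interpret ou_process a b c M W X T
    using BM X_meas X_sol by (intro ou_process.intro brownian.intro brownian_axioms.intro ou_process_axioms.intro)
  define e where "e = (\<lambda>i. running_exponent (T / real n) u1 u2 u3 p p2 p3 (real i * T / real n))"
  define g where "g = (\<lambda>x. v T * complex_of_real (pseries q x))"
  have grid: "strict_mono (\<lambda>i. real i * T / real n)" "0 \<le> real 0 * T / real n" "real n * T / real n = T"
    using T_pos n_pos by (auto simp: strict_mono_def divide_strict_right_mono)
  have cont: "continuous_on UNIV (e i)" "continuous_on UNIV g" for i
    unfolding e_def g_def using p_negl
    by (intro continuous_on_running_exponent continuous_intros continuous_on_of_real_pseries; simp)+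
  have "real i * T / real n \<in> {0..T}" if "i < n" for i
    using that T_pos by (auto simp: divide_le_eq)
  hence nonpos: "Re (e i x) \<le> 0" if "i < n" for i x
    unfolding e_def using that T_pos u_re p_negl(1) by (intro Re_running_exponent_nonpos) auto
  have "f t x = (\<integral>\<omega>. exp ((\<Sum>i | i < n \<and> t \<le> real i * T / real n. e i (X t x (real i * T / real n) \<omega>))
      + g (X t x T \<omega>)) \<partial>M)" for t x
    unfolding f_def e_def g_def running_exponent_def ..
  note functional = exponential_sampled_functional[OF c_ne grid j_lt cont(1) nonpos cont(2) _ this]
  show ?thesis
    using functional u_re(4)[of T] T_pos
    by (simp add: backward_solution_on_def g_def e_def running_exponent_def)
qed

end
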